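(* For all sufficiently large $x$, $$m_{\omega}(x):=\sum_{n\le x}\frac{\mu(n)\omega(n)}{n}=O\!\left(\frac{\sqrt{\log\log x}}{\sqrt{\log x}}\right).$$ In particular, $$\sum_{n=1}^{\infty}\frac{\mu(n)\omega(n)}{n}=\sum_{n=2}^{\infty}\frac{\mu(n)\omega(n)}{n}=0.$$
   Context: $\mu$ is the Möbius function and $\omega(n)$ is the number of distinct prime factors of $n$ (with $\omega(1)=0$). *)

theory Defs
  imports
    "HOL-Analysis.Analysis"
    "HOL-Computational_Algebra.Squarefree"
    "HOL-Library.Landau_Symbols"
begin

definition omega :: "nat \<Rightarrow> nat" where
  "omega n = card (prime_factors n)"

(* squarefree 0 is false, so moebius_mu 0 = 0. *)
definition moebius_mu :: "nat \<Rightarrow> int" where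
  "moebius_mu n = (if squarefree n then (- 1) ^ card (prime_factors n) else 0)"

definition m_omega :: "real \<Rightarrow> real" where
  "m_omega x = (\<Sum>n | 1 \<le> n \<and> real n \<le> x. real_of_int (moebius_mu n) * real (omega n) / real n)"

end

theory Submission
  imports
    Defs
    "HOL-Probability.Probability"
    "HOL-Complex_Analysis.Complex_Analysis"
    "HOL-Real_Asymp.Real_Asymp"
begin

text \<open>
  Sorting the terms of the sum by the prime factors of the index gives
  \<open>m_omega x = - (\<Sum>p\<le>x. m\<^sub>p (x / p) / p)\<close>, where \<open>m\<^sub>p\<close> is the summatory function of
  \<open>\<mu>(n) / n\<close> restricted to \<open>n\<close> prime to \<open>p\<close>. It satisfies \<open>m\<^sub>p x = m x + m\<^sub>p (x / p) / p\<close>, so any bound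
  \<open>m x = O((log x) powr -a)\<close> with \<open>a < 1\<close> passes to \<open>m\<^sub>p\<close> uniformly in \<open>p\<close>, and with Chebyshev's estimate on
  dyadic intervals it yields \<open>O((log x) powr -a * log log x)\<close> for the original sum. We take \<open>a = 3/5\<close>, so that
  the result is even \<open>O(1 / sqrt (log x))\<close>.

  The decay of \<open>m\<close> is a prime number theorem with error term. The function \<open>m (exp u)\<close> has the Laplace
  transform \<open>1 / H w\<close> with \<open>H w = w * \<zeta>(1 + w)\<close>. A power bound for \<open>\<zeta>\<close> slightly to the left of
  \<open>Re s = 1\<close>, Cauchy's estimate for \<open>H'\<close> and the 3-4-1 inequality show that the derivative of \<open>1 / H\<close> is
  \<open>O((1 + \<bar>Im w\<bar>) powr -1/2)\<close> uniformly for small \<open>Re w > 0\<close>. Averaging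
  \<open>m (exp u) * exp (-u/X) * (1 - exp (\<i> * \<pi> * u / X))\<close> over a Gaussian window around \<open>X\<close> turns the Lipschitz
  bound for \<open>1 / H\<close> at distance \<open>\<pi> / X\<close> into a bound for \<open>m (exp X)\<close>; no contour integration is needed.
\<close>

section \<open>The Euler product and the 3-4-1 inequality\<close>

text \<open>The negative logarithm of the left side is a series whose terms are
  \<open>r ^ n / n\<close> times \<open>3 + 4 * cos + cos\<close> of the doubled angle, the angle
  being that of \<open>z ^ n\<close>. This combination is twice the square of
  \<open>1 + cos\<close>, so every term is nonnegative.\<close>

lemma euler_factor_341:
  fixes r :: real and z :: complex
  assumes r: "0 \<le> r" "r < 1" and z: "norm z = 1"
  shows "norm (1 - complex_of_real r) ^ 3 * norm (1 - of_real r * z) ^ 4 * norm (1 - of_real r * z\<^sup>2) \<le> 1"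
proof -
  \<comment> \<open>Real part of the logarithm series. The term at \<open>n = 0\<close> is 0 because
    division by zero yields 0.\<close>
  have ser: "(\<lambda>n. r ^ n * Re (w ^ n) / real n) sums (- ln (norm (1 - of_real r * w)))"
    and pos: "norm (1 - of_real r * w) > 0" if w: "norm w = 1" for w :: complex
  proof -
    have lt: "norm (of_real r * w) < 1"
      using r w by (simp add: norm_mult)
    hence ne: "1 - of_real r * w \<noteq> 0"
      by (metis norm_one order_less_irrefl right_minus_eq)
    thus "norm (1 - of_real r * w) > 0" by simp
    have "(\<lambda>n. - ((-(- (of_real r * w)))^n) / of_nat n) sums ln (1 + (- (of_real r * w)))"
      by (rule Ln_series') (use lt in simp)
    hence "(\<lambda>n. Re (- ((of_real r * w)^n) / of_nat n)) sums Re (ln (1 - of_real r * w))"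
      using sums_Re by fastforce
    hence "(\<lambda>n. - (r ^ n * Re (w ^ n) / real n)) sums ln (norm (1 - of_real r * w))"
      using ne by (simp add: power_mult_distrib flip: of_real_power)
    from sums_minus[OF this] show "(\<lambda>n. r ^ n * Re (w ^ n) / real n) sums (- ln (norm (1 - of_real r * w)))"
      by simp
  qed
  have z2: "norm (z\<^sup>2) = 1" using z by (simp add: norm_power)
  let ?a = "norm (1 - of_real r * (1::complex))" and ?b = "norm (1 - of_real r * z)"
    and ?c = "norm (1 - of_real r * z\<^sup>2)"
  have sm: "(\<lambda>n. 3 * (r ^ n * Re (1 ^ n) / real n) + 4 * (r ^ n * Re (z ^ n) / real n) +
           r ^ n * Re ((z\<^sup>2) ^ n) / real n)
      sums (3 * (- ln ?a) + 4 * (- ln ?b) + (- ln ?c))"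
    by (intro sums_add sums_mult ser) (use z z2 in auto)
  have nn: "0 \<le> 3 * (r ^ n * Re (1 ^ n) / real n) + 4 * (r ^ n * Re (z ^ n) / real n) +
           r ^ n * Re ((z\<^sup>2) ^ n) / real n" for n
  proof -
    have "norm (z ^ n) = 1" using z by (simp add: norm_power)
    hence "(Re (z ^ n))\<^sup>2 + (Im (z ^ n))\<^sup>2 = 1" by (simp add: cmod_def)
    moreover have "Re ((z\<^sup>2) ^ n) = (Re (z ^ n))\<^sup>2 - (Im (z ^ n))\<^sup>2"
      by (metis Re_power2 power_commutes power_mult mult.commute)
    ultimately have eq: "3 + 4 * Re (z ^ n) + Re ((z\<^sup>2) ^ n) = 2 * (1 + Re (z ^ n))\<^sup>2"
      by (simp add: power2_eq_square algebra_simps)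
    have "3 * (r ^ n * Re (1 ^ n) / real n) + 4 * (r ^ n * Re (z ^ n) / real n) +
           r ^ n * Re ((z\<^sup>2) ^ n) / real n = r ^ n / real n * (3 + 4 * Re (z ^ n) + Re ((z\<^sup>2) ^ n))"
      by (simp add: add_divide_distrib algebra_simps)
    also have "3 + 4 * Re (z ^ n) + Re ((z\<^sup>2) ^ n) = 2 * (1 + Re (z ^ n))\<^sup>2" by (rule eq)
    finally show ?thesis using r by simp
  qed
  have "0 \<le> 3 * (- ln ?a) + 4 * (- ln ?b) + (- ln ?c)"
    by (rule sums_le[OF nn sums_zero sm])
  moreover have pos': "?a > 0" "?b > 0" "?c > 0" using pos[OF norm_one] pos[OF z] pos[OF z2] by auto
  ultimately have "ln (?a ^ 3 * ?b ^ 4 * ?c) \<le> 0"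
    by (simp add: ln_mult ln_realpow)
  hence "?a ^ 3 * ?b ^ 4 * ?c \<le> 1"
    using pos' by (subst (asm) ln_le_zero_iff) auto
  thus ?thesis by simp
qed

section \<open>Dirichlet series sieved by small primes\<close>

definition npowr :: "complex \<Rightarrow> nat \<Rightarrow> complex" where
  "npowr s n = of_nat n powr (- s)"

lemma npowr_mult: "npowr s (a * b) = npowr s a * npowr s b"
  unfolding npowr_def of_nat_mult by (rule powr_times_real) auto

lemma npowr_add: "npowr (a + b) n = npowr a n * npowr b n"
  by (simp add: npowr_def flip: powr_add)

lemma npowr_0 [simp]: "npowr s 0 = 0" and npowr_1 [simp]: "npowr s (Suc 0) = 1"
  by (auto simp: npowr_def)

lemma norm_npowr: "norm (npowr s n) = real n powr (- Re s)"
  by (cases "n = 0") (auto simp: npowr_def norm_powr_real_powr)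

lemma summable_npowr: "Re s > 1 \<Longrightarrow> summable (\<lambda>n. norm (npowr s n))"
  unfolding norm_npowr by (subst summable_real_powr_iff) auto

lemma npowr_abs_summable_on:
  assumes "Re s > 1" "\<And>n. norm (f n) \<le> (1::real)"
  shows "(\<lambda>n. norm (f n * npowr s n)) summable_on A"
proof -
  have "summable (\<lambda>n. norm (f n * npowr s n))"
    using summable_npowr[OF assms(1)]
    by (rule summable_comparison_test'[of _ 0]) (use assms(2) in \<open>auto simp: norm_mult mult_left_le_one_le\<close>)
  hence "(\<lambda>n. norm (f n * npowr s n)) summable_on UNIV"
    by (intro norm_summable_imp_summable_on) auto
  thus ?thesis by (rule summable_on_subset_banach) auto
qed

text \<open>The sieve is indexed by all naturals \<open>k\<close>, not by primes, so that it runs by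
  plain induction; a step from \<open>k\<close> to \<open>Suc k\<close> removes the multiples of
  \<open>k\<close> if \<open>k\<close> is prime and does nothing otherwise.\<close>

definition rough :: "nat \<Rightarrow> nat set" where
  "rough k = {n. 0 < n \<and> (\<forall>p. prime p \<longrightarrow> p < k \<longrightarrow> \<not> p dvd n)}"

lemma rough_0: "rough 0 = {0<..}"
  by (auto simp: rough_def)

lemma one_in_rough: "Suc 0 \<in> rough k"
  by (auto simp: rough_def)

text \<open>A number other than 1 has a prime factor, which here is at least \<open>k\<close>. Hence
  sums over \<open>rough k\<close> consist of the term at 1 and part of a tail.\<close>

lemma rough_subset: "rough k - {Suc 0} \<subseteq> {k..}"
proof
  fix n assume n: "n \<in> rough k - {Suc 0}"
  then obtain p where "prime p" "p dvd n" using prime_factor_nat[of n] by auto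
  with n have "p \<ge> k" "p \<le> n" by (auto simp: rough_def dvd_imp_le not_less)
  thus "n \<in> {k..}" by simp
qed

lemma rough_Suc_not_prime: "\<not> prime k \<Longrightarrow> rough (Suc k) = rough k"
  by (auto simp: rough_def less_Suc_eq)

text \<open>One step of the sieve of Eratosthenes: dividing a multiple of \<open>k\<close> by
  \<open>k\<close> stays in \<open>rough k\<close>, not in \<open>rough (Suc k)\<close>, since
  \<open>k\<close> may divide repeatedly.\<close>

lemma rough_Suc_prime: 
  assumes "prime k" 
  shows "rough k = rough (Suc k) \<union> (\<lambda>n. k * n) ` rough k" "rough (Suc k) \<inter> (\<lambda>n. k * n) ` rough k = {}"
proof -
  have *: "k * n \<in> rough k \<longleftrightarrow> n \<in> rough k" for n
    using assms by (auto simp: rough_def prime_dvd_mult_iff prime_gt_0_nat dest: primes_dvd_imp_eq)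
  show "rough k = rough (Suc k) \<union> (\<lambda>n. k * n) ` rough k"
  proof (intro equalityI subsetI)
    fix n assume n: "n \<in> rough k"
    show "n \<in> rough (Suc k) \<union> (\<lambda>n. k * n) ` rough k"
    proof (cases "k dvd n")
      case True
      then obtain m where "n = k * m" by (elim dvdE)
      with n show ?thesis by (auto simp: *)
    next
      case False
      with n show ?thesis by (auto simp: rough_def less_Suc_eq)
    qed
  next
    fix n assume "n \<in> rough (Suc k) \<union> (\<lambda>n. k * n) ` rough k"
    moreover have "rough (Suc k) \<subseteq> rough k" by (auto simp: rough_def)
    ultimately show "n \<in> rough k" using * by blast
  qed
  show "rough (Suc k) \<inter> (\<lambda>n. k * n) ` rough k = {}"
    using assms by (auto simp: rough_def)
qed

text \<open>A partial product for the reciprocal of zeta; this orientation avoids division.\<close>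

definition euler_prod :: "nat \<Rightarrow> complex \<Rightarrow> complex" where
  "euler_prod k s = (\<Prod>p | prime p \<and> p < k. 1 - npowr s p)"

lemma euler_prod_0 [simp]: "euler_prod 0 s = 1"
  by (simp add: euler_prod_def)

lemma euler_prod_Suc: "euler_prod (Suc k) s = (if prime k then (1 - npowr s k) else 1) * euler_prod k s"
proof -
  have "{p. prime p \<and> p < Suc k} = (if prime k then insert k {p. prime p \<and> p < k} else {p. prime p \<and> p < k})"
    by (auto simp: less_Suc_eq)
  thus ?thesis by (auto simp: euler_prod_def)
qed

text \<open>Only the term at 1 survives; the others are dominated by the tail from \<open>k\<close>
  of an absolutely convergent series.\<close>

lemma infsum_rough_tendsto:
  assumes s: "Re s > 1" and f: "\<And>n. norm (f n) \<le> (1::real)" and f1: "f (Suc 0) = 1"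
  shows "(\<lambda>k. \<Sum>\<^sub>\<infinity>n\<in>rough k. f n * npowr s n) \<longlonglongrightarrow> 1"
proof -
  have sm: "(\<lambda>n. norm (f n * npowr s n)) summable_on A" for A by (rule npowr_abs_summable_on[OF s f])
  have sm1: "(\<lambda>n. norm (1 * npowr s n)) summable_on A" for A by (rule npowr_abs_summable_on[OF s]) auto
  have "norm ((\<Sum>\<^sub>\<infinity>n\<in>rough k. f n * npowr s n) - 1) \<le> (\<Sum>n. norm (npowr s (n + k)))" for k
  proof -
    have "(\<Sum>\<^sub>\<infinity>n\<in>rough k. f n * npowr s n) = 1 + (\<Sum>\<^sub>\<infinity>n\<in>rough k - {Suc 0}. f n * npowr s n)"
    proof -
      have "(\<Sum>\<^sub>\<infinity>n\<in>{Suc 0} \<union> (rough k - {Suc 0}). f n * npowr s n)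
        = (\<Sum>\<^sub>\<infinity>n\<in>{Suc 0}. f n * npowr s n) + (\<Sum>\<^sub>\<infinity>n\<in>rough k - {Suc 0}. f n * npowr s n)"
        by (intro infsum_Un_disjoint abs_summable_summable[OF sm]) auto
      moreover have "{Suc 0} \<union> (rough k - {Suc 0}) = rough k" using one_in_rough[of k] by auto
      ultimately show ?thesis by (simp add: f1)
    qed
    hence "norm ((\<Sum>\<^sub>\<infinity>n\<in>rough k. f n * npowr s n) - 1) = norm (\<Sum>\<^sub>\<infinity>n\<in>rough k - {Suc 0}. f n * npowr s n)"
      by simp
    also have "\<dots> \<le> (\<Sum>\<^sub>\<infinity>n\<in>rough k - {Suc 0}. norm (f n * npowr s n))"
      by (rule norm_infsum_bound[OF sm])
    also have "\<dots> \<le> (\<Sum>\<^sub>\<infinity>n\<in>{k..}. norm (npowr s n))"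
      by (rule infsum_mono_neutral[OF sm])
         (use sm1 rough_subset[of k] f in \<open>auto simp: norm_mult mult_left_le_one_le\<close>)
    also have "{k..} = range (\<lambda>n. n + k)"
    proof (intro equalityI subsetI)
      fix n assume "n \<in> {k..}"
      hence "n = (n - k) + k" by simp
      thus "n \<in> range (\<lambda>n. n + k)" by blast
    qed auto
    also have "(\<Sum>\<^sub>\<infinity>n\<in>range (\<lambda>n. n + k). norm (npowr s n)) = (\<Sum>\<^sub>\<infinity>n. norm (npowr s (n + k)))"
      by (subst infsum_reindex) (auto simp: o_def)
    also have "\<dots> = (\<Sum>n. norm (npowr s (n + k)))"
      using summable_ignore_initial_segment[OF summable_npowr[OF s], of k]
      by (intro infsumI norm_summable_imp_has_sum summable_sums) auto
    finally show ?thesis .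
  qed
  moreover have "(\<lambda>k. \<Sum>n. norm (npowr s (n + k))) \<longlonglongrightarrow> 0"
    by (rule suminf_exist_split2[OF summable_npowr[OF s]])
  ultimately have "(\<lambda>k. (\<Sum>\<^sub>\<infinity>n\<in>rough k. f n * npowr s n) - 1) \<longlonglongrightarrow> 0"
    by (auto intro: Lim_null_comparison[of _ "\<lambda>k. \<Sum>n. norm (npowr s (n + k))"])
  thus ?thesis by (rule LIM_zero_cancel)
qed

text \<open>An unordered sum, so that it can be split along sets such as
  \<open>rough k\<close>.\<close>

definition zeta_series :: "complex \<Rightarrow> complex" where
  "zeta_series s = (\<Sum>\<^sub>\<infinity>n\<in>{0<..}. npowr s n)"

definition moebius_series :: "complex \<Rightarrow> complex" where
  "moebius_series s = (\<Sum>\<^sub>\<infinity>n\<in>{0<..}. of_int (moebius_mu n) * npowr s n)"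

lemma moebius_mu_1 [simp]: "moebius_mu (Suc 0) = 1"
  by (simp add: moebius_mu_def)

lemma abs_moebius_mu_le: "\<bar>moebius_mu n\<bar> \<le> 1"
  by (auto simp: moebius_mu_def power_abs)

lemma moebius_mu_prime_mult:
  assumes "prime p"
  shows "moebius_mu (p * n) = (if p dvd n then 0 else - moebius_mu n)"
proof (cases "p dvd n")
  case True
  hence "p\<^sup>2 dvd p * n" by (auto simp: power2_eq_square)
  moreover have "\<not> p dvd 1" using assms by auto
  ultimately have "\<not> squarefree (p * n)" by (auto simp: squarefree_def)
  with True show ?thesis by (simp add: moebius_mu_def)
next
  case False
  hence n: "n \<noteq> 0" by (metis dvd_0_right)
  have cop: "coprime p n" using False assms by (simp add: prime_imp_coprime)
  have "squarefree (p * n) \<longleftrightarrow> squarefree n"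
    using cop assms squarefree_mult_coprime[of p n] squarefree_multD[of p n] squarefree_prime by auto
  moreover have "prime_factors (p * n) = insert p (prime_factors n)"
    using assms n by (subst prime_factors_product) (auto simp: prime_prime_factors)
  moreover have "p \<notin> prime_factors n" using False by auto
  ultimately show ?thesis using False by (auto simp: moebius_mu_def)
qed

text \<open>Removing the multiples of a prime \<open>k\<close> subtracts \<open>npowr s k\<close>
  times the sum over \<open>rough k\<close> itself, which multiplies the sum by
  \<open>1 - npowr s k\<close>.\<close>

lemma zeta_series_euler_prod:
  assumes s: "Re s > 1"
  shows "(\<Sum>\<^sub>\<infinity>n\<in>rough k. npowr s n) = zeta_series s * euler_prod k s"
proof (induction k)
  case 0
  show ?case by (simp add: zeta_series_def rough_0)
next
  case (Suc k)
  have sm: "npowr s summable_on A" for A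
    using abs_summable_summable[OF npowr_abs_summable_on[OF s, of "\<lambda>_. 1" A]] by simp
  show ?case
  proof (cases "prime k")
    case True
    have "(\<Sum>\<^sub>\<infinity>n\<in>rough k. npowr s n) =
      (\<Sum>\<^sub>\<infinity>n\<in>rough (Suc k). npowr s n) + (\<Sum>\<^sub>\<infinity>n\<in>(\<lambda>n. k * n) ` rough k. npowr s n)"
      by (subst rough_Suc_prime(1)[OF True]) (intro infsum_Un_disjoint sm rough_Suc_prime True)
    also have "(\<Sum>\<^sub>\<infinity>n\<in>(\<lambda>n. k * n) ` rough k. npowr s n) = npowr s k * (\<Sum>\<^sub>\<infinity>n\<in>rough k. npowr s n)"
      using True by (subst infsum_reindex)
        (auto simp: inj_on_def o_def npowr_mult infsum_cmult_right' prime_gt_0_nat)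
    finally show ?thesis using Suc True by (simp add: euler_prod_Suc algebra_simps)
  qed (use Suc in \<open>simp add: euler_prod_Suc rough_Suc_not_prime\<close>)
qed

text \<open>For the coefficients \<open>moebius_mu\<close> the sieve acts in the opposite direction:
  the sum over \<open>rough k\<close> is \<open>1 - npowr s k\<close> times the sum over
  \<open>rough (Suc k)\<close>. The Euler product therefore stands on the side of the sieved
  sum.\<close>

lemma moebius_series_euler_prod:
  assumes s: "Re s > 1"
  shows "(\<Sum>\<^sub>\<infinity>n\<in>rough k. of_int (moebius_mu n) * npowr s n) * euler_prod k s = moebius_series s"
proof (induction k)
  case 0
  show ?case by (simp add: moebius_series_def rough_0)
next
  case (Suc k)
  let ?f = "\<lambda>n. of_int (moebius_mu n) * npowr s n"
  have ab: "norm (of_int (moebius_mu n) :: complex) \<le> 1" for n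
    using abs_moebius_mu_le[of n] by (simp add: norm_of_int flip: of_int_abs)
  have sm: "?f summable_on A" for A
    using abs_summable_summable[OF npowr_abs_summable_on[OF s ab]] by simp
  show ?case
  proof (cases "prime k")
    case True
    have "(\<Sum>\<^sub>\<infinity>n\<in>rough k. ?f n) =
      (\<Sum>\<^sub>\<infinity>n\<in>rough (Suc k). ?f n) + (\<Sum>\<^sub>\<infinity>n\<in>(\<lambda>n. k * n) ` rough k. ?f n)"
      by (subst rough_Suc_prime(1)[OF True]) (intro infsum_Un_disjoint sm rough_Suc_prime True)
    also have "(\<Sum>\<^sub>\<infinity>n\<in>(\<lambda>n. k * n) ` rough k. ?f n) = (\<Sum>\<^sub>\<infinity>n\<in>rough k. ?f (k * n))"
      using True by (subst infsum_reindex) (auto simp: inj_on_def o_def prime_gt_0_nat)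
    \<comment> \<open>\<open>moebius_mu (k * n)\<close> vanishes when \<open>k\<close> divides
      \<open>n\<close>, so the range shrinks to \<open>rough (Suc k)\<close>.\<close>
    also have "\<dots> = (\<Sum>\<^sub>\<infinity>n\<in>rough (Suc k). - npowr s k * ?f n)"
      by (rule infsum_cong_neutral)
         (use True in \<open>auto simp: moebius_mu_prime_mult npowr_mult rough_def less_Suc_eq\<close>)
    also have "\<dots> = - npowr s k * (\<Sum>\<^sub>\<infinity>n\<in>rough (Suc k). ?f n)"
      by (rule infsum_cmult_right')
    finally have "(\<Sum>\<^sub>\<infinity>n\<in>rough k. ?f n) = (1 - npowr s k) * (\<Sum>\<^sub>\<infinity>n\<in>rough (Suc k). ?f n)"
      by (simp add: algebra_simps)
    thus ?thesis using Suc True by (simp add: euler_prod_Suc mult_ac)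
  qed (use Suc in \<open>simp add: euler_prod_Suc rough_Suc_not_prime\<close>)
qed

lemma zeta_series_mult_euler_prod_tendsto:
  assumes s: "Re s > 1"
  shows "(\<lambda>k. zeta_series s * euler_prod k s) \<longlonglongrightarrow> 1"
  using infsum_rough_tendsto[OF s, of "\<lambda>_. 1"] zeta_series_euler_prod[OF s] by simp

text \<open>The product of the two sieved sums does not depend on \<open>k\<close>, because the
  Euler product leaves one of them and enters the other. Both factors tend to 1.\<close>

lemma zeta_series_mult_moebius_series:
  assumes s: "Re s > 1"
  shows "zeta_series s * moebius_series s = 1"
proof -
  let ?D = "\<lambda>k. \<Sum>\<^sub>\<infinity>n\<in>rough k. of_int (moebius_mu n) * npowr s n"
  have ab: "norm (of_int (moebius_mu n) :: complex) \<le> 1" for n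
    using abs_moebius_mu_le[of n] by (simp add: norm_of_int flip: of_int_abs)
  have "(\<lambda>k. ?D k * (zeta_series s * euler_prod k s)) \<longlonglongrightarrow> 1 * 1"
    by (intro tendsto_mult infsum_rough_tendsto zeta_series_mult_euler_prod_tendsto s ab) auto
  moreover have "?D k * (zeta_series s * euler_prod k s) = zeta_series s * moebius_series s" for k
    using moebius_series_euler_prod[OF s, of k] by (simp add: algebra_simps)
  ultimately show ?thesis by (simp add: LIMSEQ_const_iff)
qed

text \<open>The local inequality, multiplied over the primes below \<open>k\<close>, bounds the
  combined Euler products by 1. Times the three zeta values they tend to 1, which forces the zeta
  side to be at least 1.\<close>

lemma zeta_series_341:
  assumes "\<sigma> > 1"
  shows "norm (zeta_series (of_real \<sigma>)) ^ 3 * norm (zeta_series (Complex \<sigma> t)) ^ 4 * norm (zeta_series (Complex \<sigma> (2 * t))) \<ge> 1"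
proof -
  let ?s = "of_real \<sigma> :: complex" and ?s1 = "Complex \<sigma> t" and ?s2 = "Complex \<sigma> (2 * t)"
  define Z where "Z = norm (zeta_series ?s) ^ 3 * norm (zeta_series ?s1) ^ 4 * norm (zeta_series ?s2)"
  define P where "P k = norm (euler_prod k ?s) ^ 3 * norm (euler_prod k ?s1) ^ 4 * norm (euler_prod k ?s2)" for k
  have "P k \<le> 1" for k
  proof -
    have "P k = (\<Prod>p | prime p \<and> p < k. norm (1 - npowr ?s p) ^ 3 * norm (1 - npowr ?s1 p) ^ 4 * norm (1 - npowr ?s2 p))"
      by (simp add: P_def euler_prod_def prod.distrib prod_power_distrib flip: prod_norm)
    also have "\<dots> \<le> 1"
    proof (intro prod_le_1 conjI)
      fix p assume "p \<in> {p. prime p \<and> p < k}"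
      hence p: "p > 1" using prime_gt_1_nat by blast
      define r where "r = real p powr (- \<sigma>)"
      define z where "z = npowr (Complex 0 t) p"
      have r: "0 \<le> r" "r < 1" using p assms by (auto simp: r_def powr_less_one)
      have z: "norm z = 1" using p by (simp add: z_def norm_npowr)
      have 0: "npowr ?s p = of_real r" 
        using powr_of_real[of "real p" "-\<sigma>"] by (simp add: npowr_def r_def)
      have 1: "npowr ?s1 p = of_real r * z"
        unfolding 0[symmetric] z_def npowr_add[symmetric] by (rule arg_cong[where f = "\<lambda>s. npowr s p"])
          (simp add: complex_eq_iff)
      have 2: "npowr ?s2 p = of_real r * z\<^sup>2"
        unfolding 0[symmetric] z_def power2_eq_square npowr_add[symmetric] 
        by (rule arg_cong[where f = "\<lambda>s. npowr s p"]) (simp add: complex_eq_iff)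
      show "norm (1 - npowr ?s p) ^ 3 * norm (1 - npowr ?s1 p) ^ 4 * norm (1 - npowr ?s2 p) \<le> 1"
        unfolding 0 1 2 by (rule euler_factor_341[OF r z])
    qed auto
    finally show ?thesis .
  qed
  hence "Z * P k \<le> Z" for k
    by (intro mult_left_le) (auto simp: Z_def)
  moreover have "(\<lambda>k. norm (zeta_series ?s * euler_prod k ?s) ^ 3 * norm (zeta_series ?s1 * euler_prod k ?s1) ^ 4 * 
      norm (zeta_series ?s2 * euler_prod k ?s2)) \<longlonglongrightarrow> norm (1::complex) ^ 3 * norm (1::complex) ^ 4 * norm (1::complex)"
    by (intro tendsto_intros zeta_series_mult_euler_prod_tendsto) (use assms in auto)
  hence "(\<lambda>k. Z * P k) \<longlonglongrightarrow> 1"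
    by (simp add: Z_def P_def norm_mult power_mult_distrib mult_ac)
  ultimately have "1 \<le> Z"
    by (intro LIMSEQ_le_const2) auto
  thus ?thesis by (simp add: Z_def)
qed

section \<open>The zeta function near the line of real part one\<close>

text \<open>Mean value inequality: the derivative has norm
  \<open>norm a * v powr (Re a - 1)\<close>, which is largest at the left endpoint since
  \<open>Re a \<le> 1\<close>.\<close>

lemma norm_powr_diff_le:
  fixes a :: complex and N u :: real
  assumes N: "0 < N" "N \<le> u" and a: "Re a \<le> 1"
  shows "norm (of_real u powr a - of_real N powr a) \<le> norm a * N powr (Re a - 1) * (u - N)"
proof -
  let ?S = "closed_segment (of_real N :: complex) (of_real u)"
  have S: "\<exists>v\<ge>N. z = of_real v" if "z \<in> ?S" for z
    using that N by (auto simp: closed_segment_of_real closed_segment_eq_real_ivl)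
  have "norm (of_real u powr a - of_real N powr a :: complex) \<le> (norm a * N powr (Re a - 1)) * norm (of_real u - of_real N :: complex)"
  proof (rule field_differentiable_bound[where S = ?S and f' = "\<lambda>z. a * z powr (a - 1)"])
    fix z assume "z \<in> ?S"
    then obtain v where v: "v \<ge> N" "z = of_real v" using S by blast
    show "((\<lambda>z. z powr a) has_field_derivative a * z powr (a - 1)) (at z within ?S)"
      using v N by (intro has_field_derivative_at_within[OF has_field_derivative_powr]) auto
    have "norm (z powr (a - 1)) = v powr (Re a - 1)"
      using v N by (simp add: norm_powr_real_powr)
    also have "\<dots> \<le> N powr (Re a - 1)"
      using v N a by (intro powr_mono2') auto
    finally show "norm (a * z powr (a - 1)) \<le> norm a * N powr (Re a - 1)"
      by (simp add: norm_mult mult_left_mono)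
  qed auto
  also have "norm (of_real u - of_real N :: complex) = u - N"
    using N by (simp flip: of_real_diff)
  finally show ?thesis .
qed

text \<open>
  Times \<open>w\<close>, the error \<open>n powr (-1-w) - (integral of u powr (-1-w) over [n, n+1])\<close>, with \<open>n\<close> shifted by one.
  The factor \<open>w\<close> makes the terms entire, and their sum \<open>w * \<zeta>(1 + w) - 1\<close> has no pole at \<open>w = 0\<close>.
\<close>
definition zeta_reg_term :: "nat \<Rightarrow> complex \<Rightarrow> complex" where
  "zeta_reg_term n w = w * npowr (1 + w) (Suc n) + npowr w (Suc (Suc n)) - npowr w (Suc n)"

text \<open>Interpolates between a trivial bound and a derivative bound.\<close>

lemma min_le_powr:
  fixes y c :: real
  assumes "y > 0" "0 \<le> c" "c \<le> 1"
  shows "min 2 y \<le> 2 * y powr c"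
proof (cases "y \<le> 1")
  case True
  have "y = y powr 1" using assms by simp
  also have "\<dots> \<le> y powr c" using True assms by (intro powr_mono') auto
  finally show ?thesis using assms by (simp add: min_def)
next
  case False
  hence "1 \<le> y powr c" using assms by (intro ge_one_powr_ge_zero) auto
  thus ?thesis by (simp add: min_def)
qed

text \<open>The term is the increment over \<open>[N, N + 1]\<close> of the function
  \<open>f\<close> below, whose derivative is \<open>w\<close> times a difference of two powers.
  That difference is at most \<open>2 * A\<close> trivially and at most
  \<open>(1 + norm w) / N * A\<close> by the mean value inequality. Interpolation with exponent 1/18
  yields \<open>N powr (- 1 - Re w - 1/18)\<close>, summable for \<open>Re w \<ge> -1/36\<close>, at
  the cost of only a small power of \<open>1 + norm w\<close>.\<close>

lemma norm_zeta_reg_term_le: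
  assumes w: "Re w \<ge> -1/36"
  shows "norm (zeta_reg_term n w) \<le> 2 * norm w * (1 + norm w) powr (1/18) * real (Suc n) powr (-37/36)"
proof (cases "w = 0")
  case False
  define N where "N = real (Suc n)"
  have N: "N \<ge> 1" by (simp add: N_def)
  let ?S = "closed_segment (of_real N :: complex) (of_real (N + 1))"
  have S: "\<exists>v. N \<le> v \<and> v \<le> N + 1 \<and> z = of_real v" if "z \<in> ?S" for z
    using that N by (auto simp: closed_segment_of_real closed_segment_eq_real_ivl simp del: of_real_add)
  define f where "f = (\<lambda>z. z * (w * of_real N powr (- 1 - w)) + z powr (- w))"
  define A where "A = N powr (- 1 - Re w)"
  have "f (of_real (N + 1)) - f (of_real N) = zeta_reg_term n w"
    by (simp add: f_def zeta_reg_term_def npowr_def N_def algebra_simps)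
  moreover have "norm (f (of_real (N + 1)) - f (of_real N)) \<le> (norm w * (2 * (1 + norm w) powr (1/18) * N powr (-37/36))) * norm (of_real (N + 1) - of_real N :: complex)"
  proof (rule field_differentiable_bound[where S = ?S and f' = "\<lambda>z. w * (of_real N powr (- 1 - w) - z powr (- 1 - w))"])
    fix z assume "z \<in> ?S"
    then obtain v where v: "v \<ge> N" "v \<le> N + 1" "z = of_real v" using S by blast
    show "(f has_field_derivative w * (of_real N powr (- 1 - w) - z powr (- 1 - w))) (at z within ?S)"
    proof (rule has_field_derivative_at_within)
      have eq: "- w - 1 = - 1 - w" by simp
      have "((\<lambda>z. z powr (- w)) has_field_derivative (- w) * z powr (- 1 - w)) (at z)"
        using v N has_field_derivative_powr[of z "- w", unfolded eq] by simp
      from DERIV_add[OF DERIV_cmult_right[OF DERIV_ident, of "w * of_real N powr (- 1 - w)"] this]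
      show "(f has_field_derivative w * (of_real N powr (- 1 - w) - z powr (- 1 - w))) (at z)"
        by (simp add: f_def algebra_simps)
    qed
    let ?d = "norm (of_real N powr (- 1 - w) - z powr (- 1 - w))"
    have e: "- 1 - Re w - 1/18 \<le> -37/36" using w by argo
    have A0: "A \<ge> 0" by (simp add: A_def)
    have "?d \<le> norm (of_real N powr (- 1 - w)) + norm (z powr (- 1 - w))"
      by (rule norm_triangle_ineq4)
    also have "\<dots> = A + v powr (- 1 - Re w)"
      using v N by (simp add: norm_powr_real_powr A_def)
    also have "v powr (- 1 - Re w) \<le> A"
      unfolding A_def using v N w by (intro powr_mono2') auto
    finally have 1: "?d \<le> 2 * A" by simp
    have "?d = norm (of_real v powr (- 1 - w) - of_real N powr (- 1 - w))"
      using v by (simp add: norm_minus_commute)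
    also have "\<dots> \<le> norm (- 1 - w) * N powr (Re (- 1 - w) - 1) * (v - N)"
      by (rule norm_powr_diff_le) (use v N w in auto)
    also have "\<dots> \<le> (1 + norm w) * N powr (Re (- 1 - w) - 1) * 1"
      using v N norm_triangle_ineq4[of "-1" w] by (intro mult_mono) auto
    also have "\<dots> = (1 + norm w) / N * A"
      using N by (simp add: A_def powr_diff powr_minus field_simps power2_eq_square powr_numeral)
    finally have 2: "?d \<le> (1 + norm w) / N * A" .
    have "?d \<le> min 2 ((1 + norm w) / N) * A"
      using 1 2 by (simp add: min_def)
    also have "min 2 ((1 + norm w) / N) \<le> 2 * ((1 + norm w) / N) powr (1/18)"
      using N by (intro min_le_powr divide_pos_pos add_pos_nonneg) auto
    hence "min 2 ((1 + norm w) / N) * A \<le> 2 * ((1 + norm w) / N) powr (1/18) * A"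
      using A0 by (rule mult_right_mono)
    also have "\<dots> = 2 * (1 + norm w) powr (1/18) * N powr (- 1 - Re w - 1/18)"
      using N by (subst powr_diff) (simp add: A_def powr_divide)
    also have "\<dots> \<le> 2 * (1 + norm w) powr (1/18) * N powr (-37/36)"
      using N e by (intro mult_left_mono powr_mono) auto
    finally have "?d \<le> 2 * (1 + norm w) powr (1/18) * N powr (-37/36)" .
    thus "norm (w * (of_real N powr (- 1 - w) - z powr (- 1 - w))) \<le> norm w * (2 * (1 + norm w) powr (1/18) * N powr (-37/36))"
      by (simp add: norm_mult mult_left_mono)
  qed auto
  ultimately show ?thesis by (simp add: N_def)
next
  case True
  \<comment> \<open>At \<open>w = 0\<close> both powers equal 1 and cancel; the bases must be known
    to be nonzero because \<open>0 powr 0 = 0\<close>.\<close>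
  have "(1 + of_nat n :: complex) \<noteq> 0" "(2 + of_nat n :: complex) \<noteq> 0"
    using of_nat_neq_0[of n, where 'a = complex] of_nat_neq_0[of "Suc n", where 'a = complex] by (auto simp: add.commute)
  thus ?thesis using True by (auto simp: zeta_reg_term_def npowr_def)
qed

text \<open>This is \<open>H\<close> of the introduction: the series continues
  \<open>w * \<zeta>(1 + w)\<close> beyond the line of real part 0.\<close>

definition zeta_reg :: "complex \<Rightarrow> complex" where
  "zeta_reg w = 1 + (\<Sum>n. zeta_reg_term n w)"

definition zeta_reg_const :: real where
  "zeta_reg_const = (\<Sum>n. 2 * real (Suc n) powr (-37/36))"

lemma summable_zeta_reg_const: "summable (\<lambda>n. 2 * real (Suc n) powr (-37/36))"
  by (intro summable_mult) (subst summable_Suc_iff, subst summable_real_powr_iff, simp)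

lemma zeta_reg_const_pos: "zeta_reg_const > 0"
  unfolding zeta_reg_const_def by (rule suminf_pos[OF summable_zeta_reg_const]) simp

text \<open>Serves two purposes: \<open>zeta_reg\<close> is close to 1 near the origin, and it grows
  at most like the power 19/18 far away.\<close>

lemma norm_zeta_reg_minus_1_le:
  assumes w: "Re w \<ge> -1/36"
  shows "norm (zeta_reg w - 1) \<le> zeta_reg_const * norm w * (1 + norm w) powr (1/18)"
proof -
  have "norm (\<Sum>n. zeta_reg_term n w) \<le> (\<Sum>n. norm w * (1 + norm w) powr (1/18) * (2 * real (Suc n) powr (-37/36)))"
    by (rule norm_suminf_le) (use norm_zeta_reg_term_le[OF w] summable_mult[OF summable_zeta_reg_const] in \<open>auto simp: mult_ac\<close>)
  also have "\<dots> = norm w * (1 + norm w) powr (1/18) * zeta_reg_const"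
    unfolding zeta_reg_const_def by (rule suminf_mult[OF summable_zeta_reg_const])
  finally show ?thesis by (simp add: zeta_reg_def mult_ac)
qed

text \<open>On a closed disc inside the half-plane the term bound is uniform, so the Weierstrass
  M-test applies.\<close>

lemma zeta_reg_holomorphic: "zeta_reg holomorphic_on {w. Re w > -1/36}"
proof (rule holomorphic_uniform_sequence[where f = "\<lambda>m w. 1 + (\<Sum>n<m. zeta_reg_term n w)"])
  show "open {w. Re w > -1/36}" by (rule open_halfspace_Re_gt)
  show "(\<lambda>w. 1 + (\<Sum>n<m. zeta_reg_term n w)) holomorphic_on {w. Re w > -1/36}" for m
    unfolding zeta_reg_term_def npowr_def by (intro holomorphic_intros)
  fix x :: complex assume "x \<in> {w. Re w > -1/36}"
  then obtain d where d: "d > 0" "cball x d \<subseteq> {w. Re w > -1/36}"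
    using open_contains_cball[of "{w. Re w > -1/36}"] open_halfspace_Re_gt[of "-1/36"] by blast
  define R where "R = norm x + d"
  have "uniform_limit (cball x d) (\<lambda>m w. \<Sum>n<m. zeta_reg_term n w) (\<lambda>w. \<Sum>n. zeta_reg_term n w) sequentially"
  proof (rule Weierstrass_m_test)
    fix n w assume w: "w \<in> cball x d"
    have R: "norm w \<le> R" using w norm_triangle_ineq2[of w x] by (auto simp: R_def dist_norm norm_minus_commute)
    have "norm (zeta_reg_term n w) \<le> 2 * norm w * (1 + norm w) powr (1/18) * real (Suc n) powr (-37/36)"
      using norm_zeta_reg_term_le[of w n] w d by force
    also have "\<dots> \<le> 2 * R * (1 + R) powr (1/18) * real (Suc n) powr (-37/36)"
      using R by (intro mult_right_mono mult_mono powr_mono2) (auto intro: order_trans[OF norm_ge_zero])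
    finally show "norm (zeta_reg_term n w) \<le> R * (1 + R) powr (1/18) * (2 * real (Suc n) powr (-37/36))" by (simp add: mult_ac)
  qed (rule summable_mult[OF summable_zeta_reg_const])
  hence "uniform_limit (cball x d) (\<lambda>m w. 1 + (\<Sum>n<m. zeta_reg_term n w)) zeta_reg sequentially"
    unfolding zeta_reg_def by (intro uniform_limit_intros) 
  with d show "\<exists>d>0. cball x d \<subseteq> {w. Re w > -1/36} \<and>
         uniform_limit (cball x d) (\<lambda>m w. 1 + (\<Sum>n<m. zeta_reg_term n w)) zeta_reg sequentially" by blast
qed

lemma zeta_series_sums: "Re s > 1 \<Longrightarrow> (\<lambda>n. npowr s (Suc n)) sums zeta_series s"
proof -
  assume s: "Re s > 1"
  have r: "range Suc = {0<..}" by (auto simp: greaterThan_0)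
  have "zeta_series s = (\<Sum>\<^sub>\<infinity>n\<in>range Suc. npowr s n)" by (simp add: zeta_series_def r)
  also have "\<dots> = (\<Sum>\<^sub>\<infinity>n. npowr s (Suc n))" by (subst infsum_reindex) (auto simp: o_def)
  finally have eq: "zeta_series s = (\<Sum>\<^sub>\<infinity>n. npowr s (Suc n))" .
  have sm: "summable (\<lambda>n. norm (npowr s (Suc n)))"
    using summable_npowr[OF s] by (subst summable_Suc_iff)
  have "((\<lambda>n. npowr s (Suc n)) has_sum (\<Sum>n. npowr s (Suc n))) UNIV"
    by (intro norm_summable_imp_has_sum summable_sums summable_norm_cancel[OF sm] sm)
  hence "zeta_series s = (\<Sum>n. npowr s (Suc n))" using eq infsumI by metis
  thus ?thesis using summable_norm_cancel[OF sm] by (simp add: sums_iff)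
qed

text \<open>For \<open>Re w > 0\<close> the differences in the terms telescope to -1, which cancels
  the leading 1 of \<open>zeta_reg\<close>.\<close>

lemma zeta_reg_eq:
  assumes "Re w > 0"
  shows "zeta_reg w = w * zeta_series (1 + w)"
proof -
  have "(\<lambda>n. npowr w n) \<longlonglongrightarrow> 0"
  proof (rule tendsto_norm_zero_cancel)
    have "(\<lambda>n. real n powr (- Re w)) \<longlonglongrightarrow> 0" using assms by real_asymp
    thus "(\<lambda>n. norm (npowr w n)) \<longlonglongrightarrow> 0" by (simp add: norm_npowr)
  qed
  hence "(\<lambda>n. npowr w (Suc n)) \<longlonglongrightarrow> 0" by (rule LIMSEQ_Suc)
  hence "(\<lambda>n. npowr w (Suc (Suc n)) - npowr w (Suc n)) sums (0 - npowr w (Suc 0))"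
    by (rule telescope_sums)
  moreover have "(\<lambda>n. w * npowr (1 + w) (Suc n)) sums (w * zeta_series (1 + w))"
    using assms by (intro sums_mult zeta_series_sums) auto
  ultimately have "(\<lambda>n. w * npowr (1 + w) (Suc n) + (npowr w (Suc (Suc n)) - npowr w (Suc n))) sums (w * zeta_series (1 + w) + (0 - npowr w (Suc 0)))"
    by (intro sums_add)
  hence "(\<lambda>n. zeta_reg_term n w) sums (w * zeta_series (1 + w) - 1)"
    by (simp add: zeta_reg_term_def add_diff_eq)
  thus ?thesis by (simp add: zeta_reg_def sums_iff)
qed

lemma zeta_reg_nonzero: "Re w > 0 \<Longrightarrow> zeta_reg w \<noteq> 0"
  using zeta_series_mult_moebius_series[of "1 + w"] by (auto simp: zeta_reg_eq)

lemma inverse_zeta_reg_eq: "Re w > 0 \<Longrightarrow> 1 / zeta_reg w = moebius_series (1 + w) / w"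
  using zeta_series_mult_moebius_series[of "1 + w"] by (auto simp: zeta_reg_eq divide_simps mult_ac)

text \<open>Cauchy's estimate on a disc of radius 1/40. Since 1/40 < 1/36, the disc stays where
  \<open>zeta_reg\<close> is holomorphic and the power bound holds.\<close>

lemma norm_deriv_zeta_reg_le: 
  obtains C where "C > 0" "\<And>w. Re w \<ge> 0 \<Longrightarrow> norm (deriv zeta_reg w) \<le> C * (1 + norm w) powr (19/18)"
proof
  \<comment> \<open>40 is the reciprocal radius; \<open>2 powr (19/18)\<close> pays for
    \<open>1 + norm z \<le> 2 * (1 + norm w)\<close> on the circle.\<close>
  define K where "K = 40 * (1 + zeta_reg_const * 2 powr (19/18))"
  show "K > 0" unfolding K_def using zeta_reg_const_pos by (intro mult_pos_pos add_pos_pos) auto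
  fix w :: complex assume w: "Re w \<ge> 0"
  define B where "B = (1 + zeta_reg_const * 2 powr (19/18)) * (1 + norm w) powr (19/18)"
  have sub: "cball w (1/40) \<subseteq> {w. Re w > -1/36}"
  proof
    fix z assume "z \<in> cball w (1/40)"
    hence "norm (w - z) \<le> 1/40" by (simp add: dist_norm)
    hence "\<bar>Re (w - z)\<bar> \<le> 1/40" using abs_Re_le_cmod[of "w - z"] by linarith
    hence "Re w - Re z \<le> 1/40" unfolding minus_complex.sel by linarith
    thus "z \<in> {w. Re w > -1/36}" using w by auto
  qed
  have "norm ((deriv ^^ 1) zeta_reg w) \<le> fact 1 * B / (1/40) ^ 1"
  proof (rule Cauchy_inequality)
    show "zeta_reg holomorphic_on ball w (1/40)"
      using sub ball_subset_cball by (blast intro: holomorphic_on_subset[OF zeta_reg_holomorphic])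
    show "continuous_on (cball w (1/40)) zeta_reg"
      using sub by (blast intro: holomorphic_on_imp_continuous_on holomorphic_on_subset[OF zeta_reg_holomorphic])
    fix z assume z: "cmod (w - z) = 1/40"
    have "z \<in> cball w (1/40)" using z by (simp add: dist_norm)
    with sub have re: "Re z > -1/36" by blast
    have nz: "norm z \<le> norm w + 1"
      using norm_triangle_ineq2[of z w] z by (simp add: norm_minus_commute)
    have nz': "1 + norm z \<le> 2 * (1 + norm w)" using nz norm_ge_zero[of w] by argo
    have "norm (zeta_reg z) \<le> 1 + norm (zeta_reg z - 1)"
      using norm_triangle_ineq[of 1 "zeta_reg z - 1"] by simp
    also have "norm (zeta_reg z - 1) \<le> zeta_reg_const * norm z * (1 + norm z) powr (1/18)"
      by (rule norm_zeta_reg_minus_1_le) (use re in simp)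
    also have "\<dots> \<le> zeta_reg_const * (1 + norm z) * (1 + norm z) powr (1/18)"
      using zeta_reg_const_pos by (intro mult_right_mono mult_left_mono) auto
    also have "\<dots> = zeta_reg_const * (1 + norm z) powr (19/18)"
      using powr_add[of "1 + norm z" 1 "1/18"] by (simp add: add_nonneg_eq_0_iff)
    also have "\<dots> \<le> zeta_reg_const * (2 * (1 + norm w)) powr (19/18)"
      using zeta_reg_const_pos nz' by (intro mult_left_mono powr_mono2) auto
    also have "\<dots> = zeta_reg_const * 2 powr (19/18) * (1 + norm w) powr (19/18)"
      by (subst powr_mult) auto
    finally have "norm (zeta_reg z) \<le> 1 + zeta_reg_const * 2 powr (19/18) * (1 + norm w) powr (19/18)" by simp
    moreover have "1 \<le> (1 + norm w) powr (19/18)" by (intro ge_one_powr_ge_zero) auto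
    ultimately show "norm (zeta_reg z) \<le> B" by (simp add: B_def algebra_simps)
  qed auto
  thus "norm (deriv zeta_reg w) \<le> K * (1 + norm w) powr (19/18)"
    by (simp add: B_def K_def algebra_simps)
qed

lemma zeta_reg_has_field_derivative: "Re w > -1/36 \<Longrightarrow> (zeta_reg has_field_derivative deriv zeta_reg w) (at w)"
  using holomorphic_derivI[OF zeta_reg_holomorphic open_halfspace_Re_gt, of w] by simp


section \<open>Lower bound for \<open>zeta_reg\<close> and Lipschitz bound for its
  reciprocal\<close>

text \<open>With \<open>\<tau> = T powr (1/72)\<close> all exponents in the next proof become natural numbers.\<close>
lemma powr_eq_power_root:
  fixes T :: real
  assumes "T > 0"
  shows "T powr (real k / 72) = (T powr (1/72)) ^ k"
  using assms by (simp add: powr_powr flip: powr_realpow)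

text \<open>With \<open>T = 1 + \<bar>t\<bar>\<close>, the 3-4-1 inequality gives a lower bound of
  order \<open>\<delta> powr (3/4) * T powr (71/72)\<close>. Moving horizontally by \<eta> costs at
  most order \<open>\<eta> * T powr (76/72)\<close>. The two balance at \<eta> of order
  \<open>T powr (-20/72)\<close>, where both have order
  \<open>T powr (56/72) = T powr (7/9)\<close>.\<close>

lemma zeta_reg_lower_bound:
  assumes r0: "r0 > 0"
  obtains c where "c > 0"
    "\<And>\<delta> t. 0 < \<delta> \<Longrightarrow> \<delta> \<le> 1 \<Longrightarrow> r0 \<le> \<bar>t\<bar> \<Longrightarrow> c * (1 + \<bar>t\<bar>) powr (7/9) \<le> norm (zeta_reg (Complex \<delta> t))"
proof -
  obtain D where D: "D > 0" "\<And>w. Re w \<ge> 0 \<Longrightarrow> norm (deriv zeta_reg w) \<le> D * (1 + norm w) powr (19/18)"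
    using norm_deriv_zeta_reg_le by blast
  \<comment> \<open>\<open>A0\<close> bounds \<open>zeta_reg\<close> at \<delta>, \<open>A1\<close>
    times a power of \<open>T\<close> bounds the quotient at \<open>2 * t\<close>, and \<kappa>
    compares \<open>norm w\<close> with \<open>T\<close>. The choice of \<open>a\<close> collects
    the constants of the 3-4-1 inequality; \<beta> is small enough that the cost of the horizontal
    move is at most half the bound.\<close>
  define A0 where "A0 = 1 + 2 * zeta_reg_const"
  define A1 where "A1 = 1 / (2 * r0) + 2 * zeta_reg_const"
  define \<kappa> where "\<kappa> = r0 / (1 + r0)"
  define a where "a = root 4 (\<kappa> ^ 4 / (A0 ^ 3 * A1))"
  define D' where "D' = D * 2 powr (19/18)"
  define \<beta> where "\<beta> = min 1 (a / (2 * D'))"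
  have A: "A0 > 0" "A1 > 0" "\<kappa> > 0" "D' > 0" using r0 zeta_reg_const_pos D by (auto simp: A0_def A1_def \<kappa>_def D'_def add_pos_pos)
  hence a: "a > 0" by (simp add: a_def)
  have a4: "a ^ 4 = \<kappa> ^ 4 / (A0 ^ 3 * A1)" using A by (simp add: a_def)
  have \<beta>: "\<beta> > 0" "\<beta> \<le> 1" "\<beta> * D' \<le> a / 2" using A a by (auto simp: \<beta>_def min_def field_simps)
  have two_powr: "(2::real) powr (1/18) \<le> 2"
    using powr_mono[of "1/18" 1 "2::real"] by simp

  \<comment> \<open>The 3-4-1 inequality solved for the fourth power. The exponent is 284 = 4 * 72 -
    4: four factors \<open>norm w\<close> of order \<open>T\<close>, less the growth
    \<open>\<tau> ^ 4\<close> at \<open>2 * t\<close>.\<close>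
  have fourth: "\<delta> ^ 3 * a ^ 4 * ((1 + \<bar>t\<bar>) powr (1/72)) ^ 284 \<le> norm (zeta_reg (Complex \<delta> t)) ^ 4"
    if \<delta>: "0 < \<delta>" "\<delta> \<le> 1" and t: "r0 \<le> \<bar>t\<bar>" for \<delta> t
  proof -
    define T where "T = 1 + \<bar>t\<bar>"
    define \<tau> where "\<tau> = T powr (1/72)"
    have T: "T \<ge> 1" by (simp add: T_def)
    have \<tau>: "\<tau> \<ge> 1" using T by (simp add: \<tau>_def ge_one_powr_ge_zero)
    have \<tau>72: "\<tau> ^ 72 = T" and \<tau>4: "\<tau> ^ 4 = T powr (1/18)"
      using powr_eq_power_root[of T 72] powr_eq_power_root[of T 4] T by (auto simp: \<tau>_def)
    let ?w = "Complex \<delta> t" and ?wa = "Complex \<delta> 0" and ?wb = "Complex \<delta> (2 * t)"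
    have "norm (zeta_reg ?wa) \<le> 1 + norm (zeta_reg ?wa - 1)"
      using norm_triangle_ineq[of 1 "zeta_reg ?wa - 1"] by simp
    also have "norm (zeta_reg ?wa - 1) \<le> zeta_reg_const * norm ?wa * (1 + norm ?wa) powr (1/18)"
      by (rule norm_zeta_reg_minus_1_le) (use \<delta> in simp)
    also have "norm ?wa = \<delta>" using \<delta> by (simp add: cmod_def)
    also have "zeta_reg_const * \<delta> * (1 + \<delta>) powr (1/18) \<le> zeta_reg_const * 1 * 2 powr (1/18)"
      using \<delta> zeta_reg_const_pos by (intro mult_mono powr_mono2) auto
    also have "\<dots> \<le> 2 * zeta_reg_const" using two_powr zeta_reg_const_pos by simp
    finally have H0: "norm (zeta_reg ?wa) \<le> A0" by (simp add: A0_def)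

    have nw2: "norm ?wb \<le> 1 + 2 * \<bar>t\<bar>" "norm ?wb \<ge> 2 * r0"
      using \<delta> t cmod_le[of ?wb] abs_Im_le_cmod[of ?wb] by auto
    have "norm (zeta_reg ?wb) \<le> 1 + norm (zeta_reg ?wb - 1)"
      using norm_triangle_ineq[of 1 "zeta_reg ?wb - 1"] by simp
    also have "norm (zeta_reg ?wb - 1) \<le> zeta_reg_const * norm ?wb * (1 + norm ?wb) powr (1/18)"
      by (rule norm_zeta_reg_minus_1_le) (use \<delta> in simp)
    finally have "norm (zeta_reg ?wb) / norm ?wb \<le> (1 + zeta_reg_const * norm ?wb * (1 + norm ?wb) powr (1/18)) / norm ?wb"
      by (intro divide_right_mono) auto
    also have "\<dots> = 1 / norm ?wb + zeta_reg_const * (1 + norm ?wb) powr (1/18)"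
    proof -
      have "norm ?wb \<noteq> 0" using nw2 r0 by argo
      thus ?thesis by (simp add: add_divide_distrib)
    qed
    also have "\<dots> \<le> 1 / (2 * r0) * \<tau> ^ 4 + zeta_reg_const * (2 * T) powr (1/18)"
    proof (intro add_mono mult_left_mono powr_mono2)
      have "1 / norm ?wb \<le> 1 / (2 * r0) * 1" using nw2 r0 by (simp add: frac_le)
      also have "\<dots> \<le> 1 / (2 * r0) * \<tau> ^ 4" using \<tau> r0 by (intro mult_left_mono) auto
      finally show "1 / norm ?wb \<le> 1 / (2 * r0) * \<tau> ^ 4" .
    qed (use nw2 zeta_reg_const_pos in \<open>auto simp: T_def\<close>)
    also have "zeta_reg_const * (2 * T) powr (1/18) \<le> 2 * zeta_reg_const * \<tau> ^ 4"
      using T zeta_reg_const_pos two_powr by (simp add: powr_mult \<tau>4 mult_right_mono)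
    finally have H2: "norm (zeta_reg ?wb) / norm ?wb \<le> A1 * \<tau> ^ 4" by (simp add: A1_def algebra_simps)

    have \<kappa>T: "\<kappa> * T \<le> norm ?w"
    proof -
      have "\<kappa> * T \<le> \<bar>t\<bar>" using t r0 by (simp add: \<kappa>_def T_def field_simps)
      also have "\<dots> \<le> norm ?w" using abs_Im_le_cmod[of ?w] by simp
      finally show ?thesis .
    qed
    have w: "norm ?w > 0" using \<delta> by (simp add: complex_eq_iff)

    have zeta_series: "norm (zeta_series (1 + w)) = norm (zeta_reg w) / norm w" if "Re w > 0" for w
      using that by (auto simp: zeta_reg_eq norm_mult)
    have "1 \<le> norm (zeta_series (of_real (1 + \<delta>))) ^ 3 * norm (zeta_series (Complex (1 + \<delta>) t)) ^ 4 * norm (zeta_series (Complex (1 + \<delta>) (2 * t)))"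
      by (rule zeta_series_341) (use \<delta> in auto)
    also have "of_real (1 + \<delta>) = 1 + ?wa" by (simp add: complex_eq_iff)
    also have "Complex (1 + \<delta>) t = 1 + ?w" by (simp add: complex_eq_iff)
    also have "Complex (1 + \<delta>) (2 * t) = 1 + ?wb" by (simp add: complex_eq_iff)
    also have "norm (zeta_series (1 + ?wa)) ^ 3 * norm (zeta_series (1 + ?w)) ^ 4 * norm (zeta_series (1 + ?wb)) =
       (norm (zeta_reg ?wa) / \<delta>) ^ 3 * (norm (zeta_reg ?w) / norm ?w) ^ 4 * (norm (zeta_reg ?wb) / norm ?wb)"
      using \<delta> by (subst (1 2 3) zeta_series) (auto simp: cmod_def)
    also have "\<dots> \<le> (A0 / \<delta>) ^ 3 * (norm (zeta_reg ?w) / (\<kappa> * T)) ^ 4 * (A1 * \<tau> ^ 4)"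
      using \<delta> H0 H2 A T \<kappa>T w by (intro mult_mono power_mono divide_right_mono divide_left_mono mult_nonneg_nonneg mult_pos_pos) auto
    also have "\<dots> = (A0 ^ 3 * A1) / \<kappa> ^ 4 * (\<tau> ^ 4 / T ^ 4) / \<delta> ^ 3 * norm (zeta_reg ?w) ^ 4"
      by (simp add: power_divide power_mult_distrib mult_ac)
    also have "(A0 ^ 3 * A1) / \<kappa> ^ 4 = 1 / a ^ 4" by (simp add: a4)
    also have "\<tau> ^ 4 / T ^ 4 = 1 / \<tau> ^ 284"
      using \<tau> by (simp add: \<tau>72[symmetric] field_simps flip: power_mult power_add)
    finally have "1 \<le> 1 / a ^ 4 * (1 / \<tau> ^ 284) / \<delta> ^ 3 * norm (zeta_reg ?w) ^ 4" .
    moreover have "a ^ 4 * \<tau> ^ 284 * \<delta> ^ 3 > 0" using a \<tau> \<delta> by simp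
    ultimately show ?thesis using \<tau> \<delta> a by (simp add: \<tau>_def T_def field_simps)
  qed

  have main: "\<beta> ^ 3 * a / 2 * (1 + \<bar>t\<bar>) powr (7/9) \<le> norm (zeta_reg (Complex \<delta> t))"
    if \<delta>: "0 < \<delta>" "\<delta> \<le> 1" and t: "r0 \<le> \<bar>t\<bar>" for \<delta> t
  proof -
    define T where "T = 1 + \<bar>t\<bar>"
    define \<tau> where "\<tau> = T powr (1/72)"
    have T: "T \<ge> 1" by (simp add: T_def)
    have \<tau>: "\<tau> \<ge> 1" using T by (simp add: \<tau>_def ge_one_powr_ge_zero)
    have \<tau>56: "\<tau> ^ 56 = T powr (7/9)" and \<tau>76: "\<tau> ^ 76 = T powr (19/18)"
      using powr_eq_power_root[of T 56] powr_eq_power_root[of T 76] T by (auto simp: \<tau>_def)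
    \<comment> \<open>Left of \<open>\<eta>\<close> the 3-4-1 bound degenerates; there the derivative bound transports the estimate from \<open>\<eta>\<close>.\<close>
    define \<eta> where "\<eta> = \<beta> ^ 4 / \<tau> ^ 20"
    have \<eta>: "0 < \<eta>" "\<eta> \<le> 1" 
    proof -
      show "0 < \<eta>" using \<beta> \<tau> by (simp add: \<eta>_def)
      have "\<beta> ^ 4 \<le> 1" "1 \<le> \<tau> ^ 20" using \<beta> \<tau> by (auto intro: power_le_one)
      hence "\<beta> ^ 4 \<le> \<tau> ^ 20" by (rule order_trans)
      thus "\<eta> \<le> 1" using \<tau> by (simp add: \<eta>_def)
    qed
    have big: "\<beta> ^ 3 * a * \<tau> ^ 56 \<le> norm (zeta_reg (Complex d t))" if d: "\<eta> \<le> d" "d \<le> 1" for d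
    proof -
      \<comment> \<open>The exponents match: 4 * 56 = 284 - 3 * 20 for \<tau>, and 4 * 3 = 3 * 4 for
        \<beta>.\<close>
      have "(\<beta> ^ 3 * a * \<tau> ^ 56) ^ 4 = \<eta> ^ 3 * a ^ 4 * \<tau> ^ 284"
        using \<tau> by (simp add: \<eta>_def power_mult_distrib power_divide field_simps flip: power_mult power_add)
      also have "\<dots> \<le> d ^ 3 * a ^ 4 * \<tau> ^ 284"
        using d \<eta> a \<tau> by (intro mult_right_mono power_mono) auto
      also have "\<dots> \<le> norm (zeta_reg (Complex d t)) ^ 4"
        using fourth[of d t] d \<eta> t by (simp add: \<tau>_def T_def)
      finally show ?thesis using power_le_imp_le_base[of "\<beta> ^ 3 * a * \<tau> ^ 56" 3 "norm (zeta_reg (Complex d t))"]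
        by (simp add: numeral_eq_Suc)
    qed
    have "\<beta> ^ 3 * a / 2 * \<tau> ^ 56 \<le> norm (zeta_reg (Complex \<delta> t))"
    proof (cases "\<eta> \<le> \<delta>")
      case True
      have "\<beta> ^ 3 * a / 2 * \<tau> ^ 56 \<le> \<beta> ^ 3 * a * \<tau> ^ 56" using \<beta> a \<tau> by simp
      also have "\<dots> \<le> norm (zeta_reg (Complex \<delta> t))" using big[of \<delta>] True \<delta> by auto
      finally show ?thesis .
    next
      case False
      let ?S = "{w. 0 \<le> Re w \<and> Re w \<le> 1 \<and> Im w = t}"
      have "norm (zeta_reg (Complex \<eta> t) - zeta_reg (Complex \<delta> t)) \<le> (D' * \<tau> ^ 76) * norm (Complex \<eta> t - Complex \<delta> t)"
      proof (rule field_differentiable_bound[where S = ?S and f' = "deriv zeta_reg"])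
        have "?S = {w. 0 \<le> Re w} \<inter> {w. Re w \<le> 1} \<inter> {w. Im w = t}" by auto
        thus "convex ?S"
          by (auto intro!: convex_Int convex_halfspace_Re_ge convex_halfspace_Re_le convex_hyperplane[of \<i> t, simplified])
        fix w assume w: "w \<in> ?S"
        show "(zeta_reg has_field_derivative deriv zeta_reg w) (at w within ?S)"
          using w by (intro has_field_derivative_at_within[OF zeta_reg_has_field_derivative]) auto
        have "1 + norm w \<le> 2 * T" using cmod_le[of w] w by (auto simp: T_def)
        hence "D * (1 + norm w) powr (19/18) \<le> D * (2 * T) powr (19/18)"
          using D by (intro mult_left_mono powr_mono2) auto
        also have "\<dots> = D' * \<tau> ^ 76" using T by (simp add: powr_mult D'_def \<tau>76)
        finally show "norm (deriv zeta_reg w) \<le> D' * \<tau> ^ 76" using D(2)[of w] w by auto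
      qed (use \<delta> \<eta> in auto)
      also have "norm (Complex \<eta> t - Complex \<delta> t) = \<eta> - \<delta>"
        using False by (simp add: cmod_def)
      also have "D' * \<tau> ^ 76 * (\<eta> - \<delta>) \<le> D' * \<tau> ^ 76 * \<eta>"
        using A \<tau> \<delta> by (intro mult_left_mono) auto
      also have "\<dots> = \<beta> ^ 3 * (\<beta> * D') * \<tau> ^ 56"
        using \<tau> by (simp add: \<eta>_def field_simps flip: power_add) (simp add: eval_nat_numeral)
      also have "\<dots> \<le> \<beta> ^ 3 * (a / 2) * \<tau> ^ 56"
        using \<beta> \<tau> by (intro mult_right_mono mult_left_mono) auto
      finally have "norm (zeta_reg (Complex \<eta> t) - zeta_reg (Complex \<delta> t)) \<le> \<beta> ^ 3 * (a / 2) * \<tau> ^ 56" .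
      moreover have "\<beta> ^ 3 * a * \<tau> ^ 56 \<le> norm (zeta_reg (Complex \<eta> t))" using big[of \<eta>] \<eta> by auto
      moreover have "norm (zeta_reg (Complex \<eta> t)) - norm (zeta_reg (Complex \<delta> t)) \<le> norm (zeta_reg (Complex \<eta> t) - zeta_reg (Complex \<delta> t))"
        by (rule norm_triangle_ineq2)
      ultimately show ?thesis by (simp add: field_simps)
    qed
    thus ?thesis by (simp add: \<tau>56 T_def)
  qed
  show ?thesis by (rule that[OF _ main]) (use \<beta> a in auto)
qed

text \<open>The exponent is 19/18 - 2 * 7/9 = -1/2. For \<open>\<bar>t\<bar>\<close> below
  \<open>r0\<close> the lower bound comes instead from \<open>zeta_reg\<close> being near 1.\<close>

lemma norm_deriv_inverse_zeta_reg_le: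
  obtains C r0 where "C > 0" "0 < r0" "r0 \<le> 1"
    "\<And>\<delta> t. 0 < \<delta> \<Longrightarrow> \<delta> \<le> r0 \<Longrightarrow> 
       norm (- deriv zeta_reg (Complex \<delta> t) / (zeta_reg (Complex \<delta> t))\<^sup>2) \<le> C * (1 + \<bar>t\<bar>) powr (-1/2)"
proof -
  obtain D where D: "D > 0" "\<And>w. Re w \<ge> 0 \<Longrightarrow> norm (deriv zeta_reg w) \<le> D * (1 + norm w) powr (19/18)"
    using norm_deriv_zeta_reg_le by blast
  define D' where "D' = D * 2 powr (19/18)"
  have D': "D' > 0" using D by (simp add: D'_def)
  \<comment> \<open>Chosen so that \<open>norm (zeta_reg w - 1) \<le> 1/2\<close> whenever
    \<open>norm w \<le> 2 * r0\<close>.\<close>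
  define r0 where "r0 = min (1/2) (1 / (8 * zeta_reg_const))"
  have r0: "r0 > 0" "r0 \<le> 1/2" "zeta_reg_const * r0 \<le> 1/8" using zeta_reg_const_pos by (auto simp: r0_def min_def field_simps)
  obtain c where c: "c > 0"
    "\<And>\<delta> t. 0 < \<delta> \<Longrightarrow> \<delta> \<le> 1 \<Longrightarrow> r0 \<le> \<bar>t\<bar> \<Longrightarrow> c * (1 + \<bar>t\<bar>) powr (7/9) \<le> norm (zeta_reg (Complex \<delta> t))"
    using zeta_reg_lower_bound[OF r0(1)] by blast
  define c' where "c' = min c (1/4)"
  have c': "c' > 0" "c' \<le> c" "c' \<le> 1/4" using c by (auto simp: c'_def)
  have two_powr: "(2::real) powr (1/18) \<le> 2" "(2::real) powr (7/9) \<le> 2"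
    using powr_mono[of "1/18" 1 "2::real"] powr_mono[of "7/9" 1 "2::real"] by simp_all
  have low: "c' * (1 + \<bar>t\<bar>) powr (7/9) \<le> norm (zeta_reg (Complex \<delta> t))" if \<delta>: "0 < \<delta>" "\<delta> \<le> r0" for \<delta> t
  proof (cases "r0 \<le> \<bar>t\<bar>")
    case True
    have "c' * (1 + \<bar>t\<bar>) powr (7/9) \<le> c * (1 + \<bar>t\<bar>) powr (7/9)"
      using c' by (intro mult_right_mono) auto
    also have "\<dots> \<le> norm (zeta_reg (Complex \<delta> t))" using c(2)[of \<delta> t] True \<delta> r0 by auto
    finally show ?thesis .
  next
    case False
    let ?w = "Complex \<delta> t"
    have w: "norm ?w \<le> 2 * r0" using cmod_le[of ?w] False \<delta> by auto
    have "norm (zeta_reg ?w - 1) \<le> zeta_reg_const * norm ?w * (1 + norm ?w) powr (1/18)"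
      by (rule norm_zeta_reg_minus_1_le) (use \<delta> in simp)
    also have "\<dots> \<le> zeta_reg_const * (2 * r0) * 2 powr (1/18)"
      using w r0 zeta_reg_const_pos by (intro mult_mono powr_mono2) auto
    also have "\<dots> \<le> zeta_reg_const * (2 * r0) * 2" using two_powr zeta_reg_const_pos r0 by (intro mult_left_mono) auto
    also have "\<dots> \<le> 1/2" using r0 by simp
    finally have "norm (zeta_reg ?w) \<ge> 1/2"
      using norm_triangle_ineq2[of 1 "1 - zeta_reg ?w"] by (simp add: norm_minus_commute)
    moreover have "c' * (1 + \<bar>t\<bar>) powr (7/9) \<le> 1/4 * 2 powr (7/9)"
      using False r0 c' by (intro mult_mono powr_mono2) auto
    ultimately show ?thesis using two_powr by linarith
  qed
  have "norm (- deriv zeta_reg (Complex \<delta> t) / (zeta_reg (Complex \<delta> t))\<^sup>2) \<le> D' / c'\<^sup>2 * (1 + \<bar>t\<bar>) powr (-1/2)"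
    if \<delta>: "0 < \<delta>" "\<delta> \<le> r0" for \<delta> t
  proof -
    define T where "T = 1 + \<bar>t\<bar>"
    have T: "T \<ge> 1" by (simp add: T_def)
    let ?w = "Complex \<delta> t"
    have "norm (deriv zeta_reg ?w) \<le> D * (1 + norm ?w) powr (19/18)" using D(2)[of ?w] \<delta> by simp
    also have "1 + norm ?w \<le> 2 * T" using cmod_le[of ?w] \<delta> r0 by (auto simp: T_def)
    hence "D * (1 + norm ?w) powr (19/18) \<le> D * (2 * T) powr (19/18)"
      using D by (intro mult_left_mono powr_mono2) auto
    also have "\<dots> = D' * T powr (19/18)" using T by (simp add: powr_mult D'_def)
    finally have 1: "norm (deriv zeta_reg ?w) \<le> D' * T powr (19/18)" .
    have "(c' * T powr (7/9))\<^sup>2 \<le> (norm (zeta_reg ?w))\<^sup>2"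
      using low[OF \<delta>, of t] c' by (intro power_mono) (auto simp: T_def)
    hence "norm (deriv zeta_reg ?w) / (norm (zeta_reg ?w))\<^sup>2 \<le> D' * T powr (19/18) / (c' * T powr (7/9))\<^sup>2"
      using c' T by (intro frac_le 1) (auto simp: D'_def D(1) less_imp_le)
    also have "(c' * T powr (7/9))\<^sup>2 = c'\<^sup>2 * T powr (14/9)"
      using T by (simp add: power_mult_distrib power2_eq_square[of "_ powr _"] flip: powr_add)
    also have "D' * T powr (19/18) / (c'\<^sup>2 * T powr (14/9)) = D' / c'\<^sup>2 * T powr (-1/2)"
      using T powr_diff[of T "19/18" "14/9"] by simp
    finally show ?thesis by (simp add: norm_divide norm_power T_def)
  qed
  moreover have "D' / c'\<^sup>2 > 0" using D' c' by simp
  ultimately show ?thesis using that r0 by force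
qed

text \<open>Mean value inequality on a vertical segment. The parameter \<open>M\<close> allows both
  a uniform bound (\<open>M = 1\<close>) and a better one on segments far from the real
  axis.\<close>

lemma inverse_zeta_reg_lipschitz:
  obtains C r0 where "C > 0" "0 < r0" "r0 \<le> 1"
    "\<And>\<delta> t1 t2 M. 0 < \<delta> \<Longrightarrow> \<delta> \<le> r0 \<Longrightarrow> t1 \<le> t2 \<Longrightarrow> (\<And>t. t1 \<le> t \<Longrightarrow> t \<le> t2 \<Longrightarrow> M \<le> 1 + \<bar>t\<bar>) \<Longrightarrow> M > 0 \<Longrightarrow>
       norm (1 / zeta_reg (Complex \<delta> t1) - 1 / zeta_reg (Complex \<delta> t2)) \<le> C * M powr (-1/2) * (t2 - t1)"
proof -
  obtain C r0 where C: "C > 0" "0 < r0" "r0 \<le> 1"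
    "\<And>\<delta> t. 0 < \<delta> \<Longrightarrow> \<delta> \<le> r0 \<Longrightarrow> 
       norm (- deriv zeta_reg (Complex \<delta> t) / (zeta_reg (Complex \<delta> t))\<^sup>2) \<le> C * (1 + \<bar>t\<bar>) powr (-1/2)"
    using norm_deriv_inverse_zeta_reg_le by blast
  have "norm (1 / zeta_reg (Complex \<delta> t1) - 1 / zeta_reg (Complex \<delta> t2)) \<le> C * M powr (-1/2) * (t2 - t1)"
    if *: "0 < \<delta>" "\<delta> \<le> r0" "t1 \<le> t2" "\<And>t. t1 \<le> t \<Longrightarrow> t \<le> t2 \<Longrightarrow> M \<le> 1 + \<bar>t\<bar>" "M > 0"
    for \<delta> t1 t2 M
  proof -
    let ?S = "{w. Re w = \<delta> \<and> t1 \<le> Im w \<and> Im w \<le> t2}"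
    have "norm (1 / zeta_reg (Complex \<delta> t1) - 1 / zeta_reg (Complex \<delta> t2)) \<le> (C * M powr (-1/2)) * norm (Complex \<delta> t1 - Complex \<delta> t2)"
    proof (rule field_differentiable_bound[where S = ?S and f' = "\<lambda>w. - deriv zeta_reg w / (zeta_reg w)\<^sup>2"])
      have "?S = {w. Re w = \<delta>} \<inter> {w. t1 \<le> Im w} \<inter> {w. Im w \<le> t2}" by auto
      thus "convex ?S"
        by (auto intro!: convex_Int convex_halfspace_Im_ge convex_halfspace_Im_le convex_hyperplane[of "1::complex" \<delta>, simplified])
      fix w assume w: "w \<in> ?S"
      have "((\<lambda>w. 1 / zeta_reg w) has_field_derivative - deriv zeta_reg w / (zeta_reg w)\<^sup>2) (at w)"
        using w * zeta_reg_nonzero[of w] zeta_reg_has_field_derivative[of w]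
        by (auto intro!: derivative_eq_intros simp: power2_eq_square)
      thus "((\<lambda>w. 1 / zeta_reg w) has_field_derivative - deriv zeta_reg w / (zeta_reg w)\<^sup>2) (at w within ?S)"
        by (rule has_field_derivative_at_within)
      have eq: "w = Complex \<delta> (Im w)" using w by (simp add: complex_eq_iff)
      have "norm (- deriv zeta_reg w / (zeta_reg w)\<^sup>2) \<le> C * (1 + \<bar>Im w\<bar>) powr (-1/2)"
        using C(4)[of \<delta> "Im w"] eq * by simp
      also have "\<dots> \<le> C * M powr (-1/2)"
        using C(1) * w by (intro mult_left_mono powr_mono2') auto
      finally show "norm (- deriv zeta_reg w / (zeta_reg w)\<^sup>2) \<le> C * M powr (-1/2)" .
    qed (use * in auto)
    also have "norm (Complex \<delta> t1 - Complex \<delta> t2) = t2 - t1"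
      using * by (simp add: cmod_def)
    finally show ?thesis .
  qed
  thus ?thesis using that C by blast
qed

section \<open>Laplace and Fourier transforms\<close>

definition moebius_sum :: "real \<Rightarrow> real" where
  "moebius_sum x = (\<Sum>n | 1 \<le> n \<and> real n \<le> x. real_of_int (moebius_mu n) / real n)"

lemma finite_nat_le_real: "finite {n. 1 \<le> n \<and> real n \<le> x}"
proof (rule finite_subset)
  show "{n. 1 \<le> n \<and> real n \<le> x} \<subseteq> {..nat \<lfloor>x\<rfloor>}" by (auto simp: le_nat_floor)
qed auto

text \<open>The real integral has a nonnegative integrand, so its integrability comes with the
  fundamental theorem; it then dominates the complex integrand.\<close>

lemma has_bochner_integral_exp_Ici:
  fixes w :: complex and a :: real
  assumes w: "Re w > 0"
  shows "has_bochner_integral lborel (\<lambda>u. indicator {a..} u *\<^sub>R exp (- w * of_real u)) (exp (- w * of_real a) / w)"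
    and "has_bochner_integral lborel (\<lambda>u. indicator {a..} u * exp (- Re w * u)) (exp (- Re w * a) / Re w)"
proof -
  let ?\<sigma> = "Re w"
  \<comment> \<open>Interval integrals run over \<open>{a<..}\<close>; the endpoint is a null
    set.\<close>
  have ae: "AE u in lborel. u \<noteq> a" by (rule AE_lborel_singleton)
  have lim: "((\<lambda>u. - exp (- ?\<sigma> * u) / ?\<sigma>) \<longlongrightarrow> 0) at_top"
    using w by real_asymp
  have D: "((\<lambda>u. - exp (- ?\<sigma> * u) / ?\<sigma>) has_real_derivative exp (- ?\<sigma> * u)) (at u)" for u
    using w by (auto intro!: derivative_eq_intros)
  have l: "(((\<lambda>u. - exp (- ?\<sigma> * u) / ?\<sigma>) \<circ> real_of_ereal) \<longlongrightarrow> - exp (- ?\<sigma> * a) / ?\<sigma>) (at_right (ereal a))"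
    unfolding ereal_tendsto_simps using w by (intro tendsto_intros) auto
  have r: "(((\<lambda>u. - exp (- ?\<sigma> * u) / ?\<sigma>) \<circ> real_of_ereal) \<longlongrightarrow> 0) (at_left \<infinity>)"
    unfolding ereal_tendsto_simps by (rule lim)
  have "isCont (\<lambda>u. exp (- ?\<sigma> * u)) u" for u by (intro continuous_intros)
  note FTC = interval_integral_FTC_nonneg[of "ereal a" \<infinity>, OF _ D this _ l r, simplified]
  have int: "set_integrable lborel {a<..} (\<lambda>u. exp (- ?\<sigma> * u))" using FTC(1) by simp
  have val: "(LBINT u:{a<..}. exp (- ?\<sigma> * u)) = exp (- ?\<sigma> * a) / ?\<sigma>"
    using FTC(2) by (simp add: interval_lebesgue_integral_def)
  have "has_bochner_integral lborel (\<lambda>u. indicator {a<..} u * exp (- ?\<sigma> * u)) (exp (- ?\<sigma> * a) / ?\<sigma>)"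
    using int val unfolding set_integrable_def set_lebesgue_integral_def by (simp add: has_bochner_integral_iff)
  thus "has_bochner_integral lborel (\<lambda>u. indicator {a..} u * exp (- ?\<sigma> * u)) (exp (- ?\<sigma> * a) / ?\<sigma>)"
    by (rule has_bochner_integralI_AE) (use ae in \<open>auto simp: indicator_def\<close>)

  have cint: "set_integrable lborel {a<..} (\<lambda>u. exp (- w * of_real u))"
    unfolding set_integrable_def
  proof (rule Bochner_Integration.integrable_bound)
    show "integrable lborel (\<lambda>u. indicator {a<..} u *\<^sub>R exp (- ?\<sigma> * u))"
      using int by (simp add: set_integrable_def)
    show "AE u in lborel. norm (indicator {a<..} u *\<^sub>R exp (- w * of_real u)) \<le> norm (indicator {a<..} u *\<^sub>R exp (- ?\<sigma> * u))"
      by (auto simp: indicator_def)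
  qed auto
  have "(LBINT u=ereal a..\<infinity>. exp (- w * of_real u)) = 0 - (- exp (- w * of_real a) / w)"
  proof (rule interval_integral_FTC_integrable[where F = "\<lambda>u. - exp (- w * of_real u) / w"])
    fix u :: real
    have "((\<lambda>z. - exp (- w * z) / w) has_field_derivative exp (- w * of_real u)) (at (of_real u))"
      using w by (auto intro!: derivative_eq_intros)
    from has_vector_derivative_real_field[OF this]
    show "((\<lambda>u. - exp (- w * of_real u) / w) has_vector_derivative exp (- w * of_real u)) (at u)" .
    show "isCont (\<lambda>u. exp (- w * complex_of_real u)) u" by (intro continuous_intros)
  next
    show "(((\<lambda>u. - exp (- w * of_real u) / w) \<circ> real_of_ereal) \<longlongrightarrow> - exp (- w * of_real a) / w) (at_right (ereal a))"
      unfolding ereal_tendsto_simps using w by (intro tendsto_intros) auto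
    have "((\<lambda>u. - exp (- w * of_real u) / w) \<longlongrightarrow> 0) at_top"
    proof (rule tendsto_norm_zero_cancel)
      have "((\<lambda>u. exp (- ?\<sigma> * u) / norm w) \<longlongrightarrow> 0) at_top"
        using w by (cases "w = 0") (auto intro!: tendsto_divide_zero, real_asymp)
      thus "((\<lambda>u. norm (- exp (- w * of_real u) / w)) \<longlongrightarrow> 0) at_top" by (simp add: norm_divide)
    qed
    thus "(((\<lambda>u. - exp (- w * of_real u) / w) \<circ> real_of_ereal) \<longlongrightarrow> 0) (at_left \<infinity>)"
      unfolding ereal_tendsto_simps .
  qed (use cint in auto)
  hence "(LBINT u:{a<..}. exp (- w * of_real u)) = exp (- w * of_real a) / w"
    by (simp add: interval_lebesgue_integral_def)
  hence "has_bochner_integral lborel (\<lambda>u. indicator {a<..} u *\<^sub>R exp (- w * of_real u)) (exp (- w * of_real a) / w)"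
    using cint unfolding set_integrable_def set_lebesgue_integral_def by (simp add: has_bochner_integral_iff)
  thus "has_bochner_integral lborel (\<lambda>u. indicator {a..} u *\<^sub>R exp (- w * of_real u)) (exp (- w * of_real a) / w)"
    by (rule has_bochner_integralI_AE) (use ae in \<open>auto simp: indicator_def\<close>)
qed

lemma moebius_series_sums: 
  assumes s: "Re s > 1" 
  shows "(\<lambda>n. of_int (moebius_mu (Suc n)) * npowr s (Suc n)) sums moebius_series s"
proof -
  let ?f = "\<lambda>n. of_int (moebius_mu n) * npowr s n"
  have r: "range Suc = {0<..}" by (auto simp: greaterThan_0)
  have ab: "norm (of_int (moebius_mu n) :: complex) \<le> 1" for n
    using abs_moebius_mu_le[of n] by (simp add: norm_of_int flip: of_int_abs)
  have "moebius_series s = (\<Sum>\<^sub>\<infinity>n\<in>range Suc. ?f n)" by (simp add: moebius_series_def r)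
  also have "\<dots> = (\<Sum>\<^sub>\<infinity>n. ?f (Suc n))" by (subst infsum_reindex) (auto simp: o_def)
  finally have eq: "moebius_series s = (\<Sum>\<^sub>\<infinity>n. ?f (Suc n))" .
  have "summable (\<lambda>n. norm (npowr s (Suc n)))"
    using summable_npowr[OF s] by (subst summable_Suc_iff)
  hence sm: "summable (\<lambda>n. norm (?f (Suc n)))"
    by (rule summable_comparison_test'[of _ 0]) (use ab in \<open>auto simp: norm_mult mult_left_le_one_le\<close>)
  have "((\<lambda>n. ?f (Suc n)) has_sum (\<Sum>n. ?f (Suc n))) UNIV"
    by (intro norm_summable_imp_has_sum summable_sums summable_norm_cancel[OF sm] sm)
  hence "moebius_series s = (\<Sum>n. ?f (Suc n))" using eq infsumI by metis
  thus ?thesis using summable_norm_cancel[OF sm] by (simp add: sums_iff)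
qed

text \<open>The index \<open>n\<close> contributes to \<open>moebius_sum (exp u)\<close> exactly for
  \<open>u \<ge> ln n\<close>. Integrating termwise gives \<open>moebius_series (1 + w) / w\<close>;
  absolute convergence for \<open>Re w > 0\<close> justifies the interchange.\<close>

lemma moebius_sum_laplace:
  assumes w: "Re w > 0"
  shows "has_bochner_integral lborel (\<lambda>u. of_real (moebius_sum (exp u)) * exp (- w * of_real u)) (1 / zeta_reg w)"
proof -
  define c where "c n = real_of_int (moebius_mu (Suc n)) / real (Suc n)" for n
  define e where "e n u = indicator {ln (real (Suc n))..} u *\<^sub>R exp (- w * of_real u)" for n and u :: real
  define f where "f n u = of_real (c n) * e n u" for n u
  have c: "\<bar>c n\<bar> \<le> 1 / real (Suc n)" for n
    using abs_moebius_mu_le[of "Suc n"] unfolding c_def by (simp add: divide_right_mono flip: of_int_abs)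
  have int: "integrable lborel (f n)" for n
    unfolding f_def e_def using has_bochner_integral_exp_Ici(1)[OF w, of "ln (real (Suc n))"]
    by (intro integrable_mult_right) (auto simp: has_bochner_integral_iff)
  have powr: "exp (- w * of_real (ln (real (Suc n)))) = npowr w (Suc n)" for n
    by (simp add: npowr_def powr_def Ln_of_nat mult_ac del: of_nat_Suc)
  have val: "integral\<^sup>L lborel (f n) = of_int (moebius_mu (Suc n)) * npowr (1 + w) (Suc n) / w" for n
  proof -
    have "integral\<^sup>L lborel (f n) = of_real (c n) * (exp (- w * of_real (ln (real (Suc n)))) / w)"
      unfolding f_def e_def using has_bochner_integral_exp_Ici(1)[OF w, of "ln (real (Suc n))"]
      by (subst integral_mult_right_zero) (auto simp: has_bochner_integral_iff)
    moreover have "npowr 1 (Suc n) = 1 / of_nat (Suc n)"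
      by (simp add: npowr_def powr_minus_divide del: of_nat_Suc)
    ultimately show ?thesis unfolding powr npowr_add by (simp add: c_def)
  qed
  have nrm: "norm (f n u) = \<bar>c n\<bar> * (indicator {ln (real (Suc n))..} u * exp (- Re w * u))" for n u
    by (simp add: f_def e_def norm_mult)
  have "(\<integral>u. norm (f n u) \<partial>lborel) = \<bar>c n\<bar> * (exp (- Re w * ln (real (Suc n))) / Re w)" for n
    unfolding nrm using has_bochner_integral_exp_Ici(2)[OF w, of "ln (real (Suc n))"]
    by (subst integral_mult_right_zero) (auto simp: has_bochner_integral_iff)
  also have "\<bar>c n\<bar> * (exp (- Re w * ln (real (Suc n))) / Re w) \<le> 1 / Re w * norm (npowr (1 + w) (Suc n))" for n
  proof -
    have ex: "exp (- Re w * ln (real (Suc n))) = real (Suc n) powr (- Re w)"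
      by (simp add: powr_def)
    have "\<bar>c n\<bar> * (exp (- Re w * ln (real (Suc n))) / Re w) \<le> 1 / real (Suc n) * (exp (- Re w * ln (real (Suc n))) / Re w)"
      using c[of n] w by (intro mult_right_mono) auto
    also have "\<dots> = 1 / real (Suc n) * (real (Suc n) powr (- Re w) / Re w)" by (simp only: ex)
    also have "1 / real (Suc n) * (real (Suc n) powr (- Re w) / Re w) = 1 / Re w * norm (npowr (1 + w) (Suc n))"
      using powr_add[of "real (Suc n)" "-1" "- Re w"] by (simp add: norm_npowr powr_minus_divide)
    finally show ?thesis .
  qed
  finally have bnd: "(\<integral>u. norm (f n u) \<partial>lborel) \<le> 1 / Re w * norm (npowr (1 + w) (Suc n))" for n .
  have "summable (\<lambda>n. norm (npowr (1 + w) (Suc n)))"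
    using summable_npowr[of "1 + w"] w by (subst summable_Suc_iff) auto
  hence smm: "summable (\<lambda>n. 1 / Re w * norm (npowr (1 + w) (Suc n)))" by (rule summable_mult)
  have sm: "summable (\<lambda>n. \<integral>u. norm (f n u) \<partial>lborel)"
  proof (rule summable_comparison_test'[OF smm, of 0])
    fix n :: nat
    have "0 \<le> (\<integral>u. norm (f n u) \<partial>lborel)" by (rule Bochner_Integration.integral_nonneg) simp
    thus "norm (\<integral>u. norm (f n u) \<partial>lborel) \<le> 1 / Re w * norm (npowr (1 + w) (Suc n))"
      using bnd[of n] by simp
  qed
  have lnle: "ln (real (Suc n)) \<le> u \<longleftrightarrow> real (Suc n) \<le> exp u" for n u
    using ln_le_cancel_iff[of "real (Suc n)" "exp u"] by simp
  \<comment> \<open>For fixed \<open>u\<close> only finitely many terms are nonzero, so pointwise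
    summability is immediate.\<close>
  have fin: "f n u = 0" if "n \<notin> {n. real (Suc n) \<le> exp u}" for n u
    using that by (auto simp: f_def e_def indicator_def lnle simp del: of_nat_Suc)
  have finS: "finite {n. real (Suc n) \<le> exp u}" for u
    by (rule finite_subset[of _ "{..nat \<lfloor>exp u\<rfloor>}"]) (auto simp: le_nat_floor)
  have ae: "AE u in lborel. summable (\<lambda>n. norm (f n u))"
    by (intro AE_I2 summable_finite[OF finS]) (use fin in auto)
  have suminf: "(\<Sum>n. f n u) = of_real (moebius_sum (exp u)) * exp (- w * of_real u)" for u
  proof -
    have "(\<Sum>n. f n u) = (\<Sum>n\<in>{n. real (Suc n) \<le> exp u}. f n u)"
      by (rule suminf_finite[OF finS fin])
    also have "\<dots> = (\<Sum>n\<in>{n. real (Suc n) \<le> exp u}. of_real (c n) * exp (- w * of_real u))"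
      by (rule sum.cong) (auto simp: f_def e_def indicator_def lnle simp del: of_nat_Suc)
    also have "\<dots> = of_real (\<Sum>n\<in>{n. real (Suc n) \<le> exp u}. c n) * exp (- w * of_real u)"
      by (simp add: sum_distrib_right)
    also have "(\<Sum>n\<in>{n. real (Suc n) \<le> exp u}. c n) = moebius_sum (exp u)"
      unfolding moebius_sum_def c_def
      by (rule sum.reindex_bij_witness[of _ "\<lambda>n. n - 1" Suc]) auto
    finally show ?thesis .
  qed
  have "(\<lambda>n. of_int (moebius_mu (Suc n)) * npowr (1 + w) (Suc n) / w) sums (moebius_series (1 + w) / w)"
    using w by (intro sums_divide moebius_series_sums) auto
  hence "(\<Sum>n. integral\<^sup>L lborel (f n)) = 1 / zeta_reg w"
    by (simp add: val sums_iff inverse_zeta_reg_eq[OF w])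
  hence "has_bochner_integral lborel (\<lambda>u. \<Sum>n. f n u) (1 / zeta_reg w)"
    using integral_suminf[OF int ae sm] integrable_suminf[OF int ae sm] by (simp add: has_bochner_integral_iff)
  thus ?thesis by (simp add: suminf)
qed

text \<open>Fubini, together with the fact that the Gaussian is its own Fourier transform up to
  scaling. The left side averages \<open>f\<close> over a window of width \<open>h\<close> at
  \<open>X\<close>; the right side sees the transform at frequencies \<open>t / h\<close>.\<close>

lemma gaussian_fourier:
  fixes f :: "real \<Rightarrow> complex" and h X :: real
  assumes f: "integrable lborel f" and h: "h > 0"
  shows "of_real (h * sqrt (2 * pi)) * (\<integral>v. f (X + h * v) \<partial>std_normal_distribution) =
    (\<integral>t. iexp (t * X / h) * (\<integral>u. f u * iexp (- (t / h) * u) \<partial>lborel) \<partial>std_normal_distribution)"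
proof -
  interpret N: prob_space std_normal_distribution by (rule prob_space_normal_density) simp
  interpret P: pair_sigma_finite lborel std_normal_distribution
    by (intro pair_sigma_finite.intro lborel.sigma_finite_measure_axioms N.sigma_finite_measure_axioms)
  have [measurable]: "f \<in> borel_measurable borel" using f by auto
  let ?g = "\<lambda>u t. f u * iexp (t * ((X - u) / h))"
  \<comment> \<open>The oscillating factor has norm 1 and the Gaussian has mass 1, so integrability
    of \<open>f\<close> suffices.\<close>
  have I: "integrable (lborel \<Otimes>\<^sub>M std_normal_distribution) (\<lambda>(u, t). ?g u t)"
  proof (rule P.Fubini_integrable)
    show "integrable lborel (\<lambda>u. \<integral>t. norm (case (u, t) of (u, t) \<Rightarrow> ?g u t) \<partial>std_normal_distribution)"
      using f by (simp add: norm_mult N.prob_space)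
    show "AE u in lborel. integrable std_normal_distribution (\<lambda>t. case (u, t) of (u, t) \<Rightarrow> ?g u t)"
      by (auto intro!: integrable_mult_right N.integrable_const_bound[of _ 1])
  qed measurable
  have "(\<integral>t. (\<integral>u. ?g u t \<partial>lborel) \<partial>std_normal_distribution) = (\<integral>u. (\<integral>t. ?g u t \<partial>std_normal_distribution) \<partial>lborel)"
    by (rule P.Fubini_integral[OF I])
  also have "\<dots> = (\<integral>u. f u * exp (- of_real (((X - u) / h)\<^sup>2 / 2)) \<partial>lborel)"
  proof (rule Bochner_Integration.integral_cong[OF refl])
    fix u
    have "(\<integral>t. ?g u t \<partial>std_normal_distribution) = f u * (\<integral>t. iexp (t * ((X - u) / h)) \<partial>std_normal_distribution)"
      by (rule integral_mult_right_zero)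
    also have "(\<integral>t. iexp (t * ((X - u) / h)) \<partial>std_normal_distribution) = char std_normal_distribution ((X - u) / h)"
      by (simp add: char_def mult_ac)
    also have "\<dots> = exp (- of_real (((X - u) / h)\<^sup>2 / 2))"
      by (simp add: char_std_normal_distribution exp_of_real[symmetric])
    finally show "(\<integral>t. ?g u t \<partial>std_normal_distribution) = f u * exp (- of_real (((X - u) / h)\<^sup>2 / 2))" .
  qed
  also have "\<dots> = \<bar>h\<bar> *\<^sub>R (\<integral>v. f (X + h * v) * exp (- of_real (((X - (X + h * v)) / h)\<^sup>2 / 2)) \<partial>lborel)"
    by (rule lborel_integral_real_affine) (use h in auto)
  also have "(\<integral>v. f (X + h * v) * exp (- of_real (((X - (X + h * v)) / h)\<^sup>2 / 2)) \<partial>lborel)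
     = (\<integral>v. of_real (sqrt (2 * pi)) * (std_normal_density v *\<^sub>R f (X + h * v)) \<partial>lborel)"
  proof (rule Bochner_Integration.integral_cong[OF refl])
    fix v
    have "((X - (X + h * v)) / h)\<^sup>2 = v\<^sup>2" using h by (simp add: field_simps)
    thus "f (X + h * v) * exp (- of_real (((X - (X + h * v)) / h)\<^sup>2 / 2)) = of_real (sqrt (2 * pi)) * (std_normal_density v *\<^sub>R f (X + h * v))"
      by (simp add: std_normal_density_def scaleR_conv_of_real exp_of_real[symmetric])
  qed
  also have "\<dots> = of_real (sqrt (2 * pi)) * (\<integral>v. std_normal_density v *\<^sub>R f (X + h * v) \<partial>lborel)"
    by (rule integral_mult_right_zero)
  also have "(\<integral>v. std_normal_density v *\<^sub>R f (X + h * v) \<partial>lborel) = (\<integral>v. f (X + h * v) \<partial>std_normal_distribution)"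
    by (rule integral_density[symmetric]) auto
  finally have "(\<integral>t. (\<integral>u. ?g u t \<partial>lborel) \<partial>std_normal_distribution) =
      of_real (h * sqrt (2 * pi)) * (\<integral>v. f (X + h * v) \<partial>std_normal_distribution)"
    using h by (simp add: scaleR_conv_of_real)
  moreover have "(\<integral>u. ?g u t \<partial>lborel) = iexp (t * X / h) * (\<integral>u. f u * iexp (- (t / h) * u) \<partial>lborel)" for t
  proof -
    have "?g u t = iexp (t * X / h) * (f u * iexp (- (t / h) * u))" for u
    proof -
      have "iexp (t * ((X - u) / h)) = iexp (t * X / h + - (t / h) * u)" by (simp add: field_simps diff_divide_distrib)
      also have "\<dots> = iexp (t * X / h) * iexp (- (t / h) * u)" by (simp only: of_real_add distrib_left exp_add)
      finally show ?thesis by simp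
    qed
    thus ?thesis by (simp only: integral_mult_right_zero)
  qed
  ultimately show ?thesis by simp
qed

section \<open>Decay of the sum of moebius_mu n / n\<close>

text \<open>Each term after the first is at most an increment of \<open>ln\<close>. The first is
  kept apart so that no logarithm of \<open>a = 0\<close> is needed.\<close>

lemma sum_inverse_le_ln:
  assumes "a < b"
  shows "(\<Sum>n\<in>{a<..b}. 1 / real n) \<le> 1 / real (Suc a) + ln (real b) - ln (real (Suc a))"
  using assms
proof (induction b)
  case (Suc b)
  show ?case
  proof (cases "a < b")
    case True
    have "1 / real (Suc b) \<le> ln (real (Suc b)) - ln (real b)"
    proof -
      have "ln (real b / real (Suc b)) \<le> real b / real (Suc b) - 1"
        using True by (intro ln_le_minus_one) auto
      also have "\<dots> = - (1 / real (Suc b))" by (simp add: field_simps)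
      finally show ?thesis using True by (simp add: ln_div)
    qed
    moreover have "{a<..Suc b} = insert (Suc b) {a<..b}" using Suc.prems by auto
    ultimately show ?thesis using Suc.IH[OF True] by simp
  next
    case False
    hence "a = b" using Suc.prems by simp
    moreover have "{b<..Suc b} = {Suc b}" by auto
    ultimately show ?thesis by simp
  qed
qed simp

lemma moebius_sum_altdef: "moebius_sum x = (\<Sum>n\<in>{0<..nat \<lfloor>x\<rfloor>}. real_of_int (moebius_mu n) / real n)"
proof -
  have "1 \<le> n \<and> real n \<le> x \<longleftrightarrow> 0 < n \<and> n \<le> nat \<lfloor>x\<rfloor>" for n
  proof -
    define k where "k = \<lfloor>x\<rfloor>"
    have "real n \<le> x \<longleftrightarrow> int n \<le> k" by (simp only: k_def le_floor_iff of_int_of_nat_eq)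
    moreover have "1 \<le> n \<and> int n \<le> k \<longleftrightarrow> 0 < n \<and> n \<le> nat k" by arith
    ultimately show ?thesis by (simp only: k_def)
  qed
  hence "{n. 1 \<le> n \<and> real n \<le> x} = {0<..nat \<lfloor>x\<rfloor>}"
    by (intro set_eqI) (simp only: mem_Collect_eq greaterThanAtMost_iff)
  thus ?thesis unfolding moebius_sum_def by (simp only:)
qed

text \<open>The summand \<open>1 / x\<close> accounts for a jump immediately after \<open>x\<close>;
  the remaining terms are controlled by the logarithm.\<close>

lemma moebius_sum_diff_le:
  assumes xy: "0 < x" "x \<le> y"
  shows "\<bar>moebius_sum y - moebius_sum x\<bar> \<le> 1 / x + ln y - ln x"
proof -
  define a b where "a = nat \<lfloor>x\<rfloor>" and "b = nat \<lfloor>y\<rfloor>"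
  have ab: "a \<le> b" unfolding a_def b_def using xy by (intro nat_mono floor_mono)
  have a: "x \<le> real (Suc a)" unfolding a_def using xy by linarith
  have b: "real b \<le> y" unfolding b_def using xy by simp
  have "{0<..b} = {0<..a} \<union> {a<..b}" using ab by auto
  hence "moebius_sum y - moebius_sum x = (\<Sum>n\<in>{a<..b}. real_of_int (moebius_mu n) / real n)"
    unfolding moebius_sum_altdef a_def[symmetric] b_def[symmetric] by (simp add: sum.union_disjoint)
  hence "\<bar>moebius_sum y - moebius_sum x\<bar> \<le> (\<Sum>n\<in>{a<..b}. \<bar>real_of_int (moebius_mu n) / real n\<bar>)" 
    by (simp only: sum_abs)
  also have "\<dots> \<le> (\<Sum>n\<in>{a<..b}. 1 / real n)"
  proof (rule sum_mono)
    fix n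
    show "\<bar>real_of_int (moebius_mu n) / real n\<bar> \<le> 1 / real n"
      using abs_moebius_mu_le[of n] by (simp add: divide_right_mono flip: of_int_abs)
  qed
  also have "\<dots> \<le> 1 / x + ln y - ln x"
  proof (cases "a < b")
    case True
    have "(\<Sum>n\<in>{a<..b}. 1 / real n) \<le> 1 / real (Suc a) + ln (real b) - ln (real (Suc a))"
      by (rule sum_inverse_le_ln[OF True])
    also have "\<dots> \<le> 1 / x + ln y - ln x"
    proof (intro diff_mono add_mono)
      show "1 / real (Suc a) \<le> 1 / x" using a xy by (intro divide_left_mono) auto
      show "ln (real b) \<le> ln y" using b True xy by (subst ln_le_cancel_iff) auto
      show "ln x \<le> ln (real (Suc a))" using a xy by (subst ln_le_cancel_iff) auto
    qed
    finally show ?thesis .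
  next
    case False
    hence "a = b" using ab by simp
    moreover have "ln x \<le> ln y" using xy by simp
    ultimately show ?thesis using xy by (simp add: add_increasing)
  qed
  finally show ?thesis .
qed

lemma moebius_sum_neg: "u < 0 \<Longrightarrow> moebius_sum (exp u) = 0"
proof -
  assume u: "u < 0"
  have "real n \<le> exp u \<Longrightarrow> \<not> 1 \<le> n" for n
    using u exp_less_one_iff[of u] by linarith
  hence "{n. 1 \<le> n \<and> real n \<le> exp u} = {}" by auto
  thus ?thesis unfolding moebius_sum_def by (simp only: sum.empty)
qed

lemma abs_moebius_sum_exp_le:
  assumes "u \<ge> 0"
  shows "\<bar>moebius_sum (exp u)\<bar> \<le> 2 + u"
proof -
  have "moebius_sum 1 = 1"
  proof -
    have "{n. 1 \<le> n \<and> real n \<le> 1} = {1}" by auto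
    thus ?thesis by (simp add: moebius_sum_def)
  qed
  thus ?thesis using moebius_sum_diff_le[of 1 "exp u"] assms by (simp add: abs_le_iff)
qed

lemma abs_moebius_sum_exp_diff_le:
  "\<bar>moebius_sum (exp u) - moebius_sum (exp v)\<bar> \<le> \<bar>u - v\<bar> + exp (- min u v)"
proof (induction u v rule: linorder_wlog)
  case (le u v)
  thus ?case using moebius_sum_diff_le[of "exp u" "exp v"] by (simp add: exp_minus field_simps abs_minus_commute)
qed (simp add: abs_minus_commute min.commute add.commute)

lemma abs_exp_neg_diff_le:
  fixes x y :: real
  assumes "0 \<le> x" "0 \<le> y"
  shows "\<bar>exp (- x) - exp (- y)\<bar> \<le> \<bar>x - y\<bar>"
  using assms
proof (induction x y rule: linorder_wlog)
  case (le x y)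
  have "exp (- x) - exp (- y) = exp (- x) * (1 - exp (- (y - x)))"
    by (simp add: right_diff_distrib flip: exp_add)
  also have "\<dots> \<le> 1 * (y - x)"
  proof (intro mult_mono)
    have "1 + - (y - x) \<le> exp (- (y - x))" by (rule exp_ge_add_one_self)
    thus "1 - exp (- (y - x)) \<le> y - x" by argo
  qed (use le in auto)
  finally show ?case using le by simp
qed (simp add: abs_minus_commute)

text \<open>The damping corresponds to evaluating the Laplace transform on the line of real part
  \<open>1 / X\<close>.\<close>

definition damped_sum :: "real \<Rightarrow> real \<Rightarrow> real" where
  "damped_sum X u = moebius_sum (exp u) * exp (- u / X)"

text \<open>At \<open>u = X\<close> the oscillating factor is 2. Its variation and that of the
  damping are of order \<open>\<bar>u - X\<bar> / X\<close>, which offsets the growth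
  \<open>2 + X\<close> of the sum. The exponential error comes from the jumps; negative
  \<open>u\<close> are included because the Gaussian window covers the whole line.\<close>

lemma damped_sum_near:
  assumes X: "X \<ge> 2"
  shows "norm (of_real (damped_sum X u) * (1 - iexp (pi * u / X)) - 2 * of_real (damped_sum X X)) \<le> 20 * \<bar>u - X\<bar> + 2 * exp (- X / 2)"
proof (cases "u < 0")
  case True
  have "\<bar>damped_sum X X\<bar> \<le> (2 + X) * 1"
    unfolding damped_sum_def abs_mult using abs_moebius_sum_exp_le[of X] X by (intro mult_mono) auto
  also have "\<dots> \<le> 2 * \<bar>u - X\<bar>" using True X by simp
  finally have "2 * \<bar>damped_sum X X\<bar> \<le> 4 * \<bar>u - X\<bar>" by simp
  also have "\<dots> \<le> 20 * \<bar>u - X\<bar> + 2 * exp (- X / 2)" by simp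
  finally show ?thesis using True by (simp add: damped_sum_def moebius_sum_neg norm_mult)
next
  case False
  hence u: "u \<ge> 0" by simp
  \<comment> \<open>For \<open>u \<ge> X / 2\<close> the jump error is exponentially small;
    otherwise it is at most 1, while \<open>\<bar>u - X\<bar> \<ge> 1\<close>.\<close>
  have E: "exp (- min u X) \<le> \<bar>u - X\<bar> + exp (- X / 2)"
  proof (cases "u \<ge> X / 2")
    case True
    hence "exp (- min u X) \<le> exp (- X / 2)" using X by (auto simp: min_def)
    thus ?thesis using abs_ge_zero[of "u - X"] by argo
  next
    case False
    hence "exp (- min u X) \<le> 1" "\<bar>u - X\<bar> \<ge> 1" using u X by auto
    thus ?thesis by (smt (verit) exp_gt_zero)
  qed
  have 1: "\<bar>damped_sum X u - damped_sum X X\<bar> \<le> 4 * \<bar>u - X\<bar> + exp (- X / 2)"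
  proof -
    have "damped_sum X u - damped_sum X X = (moebius_sum (exp u) - moebius_sum (exp X)) * exp (- u / X) + moebius_sum (exp X) * (exp (- (u / X)) - exp (- (X / X)))"
      by (simp add: damped_sum_def algebra_simps)
    also have "\<bar>\<dots>\<bar> \<le> \<bar>moebius_sum (exp u) - moebius_sum (exp X)\<bar> * exp (- u / X) + \<bar>moebius_sum (exp X)\<bar> * \<bar>exp (- (u / X)) - exp (- (X / X))\<bar>"
      by (rule order_trans[OF abs_triangle_ineq]) (simp add: abs_mult)
    also have "\<dots> \<le> (\<bar>u - X\<bar> + exp (- min u X)) * 1 + (2 + X) * \<bar>u / X - X / X\<bar>" (is "_ \<le> _ + ?R")
      using u X by (intro add_mono mult_mono abs_moebius_sum_exp_diff_le abs_moebius_sum_exp_le abs_exp_neg_diff_le) auto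
    finally have *: "\<bar>damped_sum X u - damped_sum X X\<bar> \<le> (\<bar>u - X\<bar> + exp (- min u X)) * 1 + ?R" .
    have "?R = (2 + X) / X * \<bar>u - X\<bar>" using X by (simp only: abs_divide flip: diff_divide_distrib) simp
    also have "\<dots> \<le> 2 * \<bar>u - X\<bar>" using X by (intro mult_right_mono) (auto simp: field_simps)
    finally show ?thesis using E * by argo
  qed
  have 2: "norm (1 - iexp (pi * u / X)) \<le> 2"
    using norm_triangle_ineq4[of 1 "iexp (pi * u / X)"] by simp
  have 3: "norm (1 + iexp (pi * u / X)) \<le> 4 * \<bar>u - X\<bar> / X"
  proof -
    have "pi * u / X = pi * (u - X) / X + pi" using X by (simp add: field_simps)
    hence "iexp (pi * u / X) = iexp (pi * (u - X) / X) * iexp pi"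
      by (simp only: of_real_add distrib_left exp_add)
    also have "\<dots> = - iexp (pi * (u - X) / X)" by (simp add: mult.commute)
    finally have "norm (1 + iexp (pi * u / X)) = norm (iexp (pi * (u - X) / X) - 1)"
      by (simp add: norm_minus_commute)
    also have "\<dots> \<le> \<bar>pi * (u - X) / X\<bar>" using iexp_approx1[of "pi * (u - X) / X" 0] by simp
    also have "\<dots> = pi * (\<bar>u - X\<bar> / X)" using X by (simp add: abs_mult)
    also have "\<dots> \<le> 4 * (\<bar>u - X\<bar> / X)" using pi_less_4 X by (intro mult_right_mono) auto
    finally show ?thesis by simp
  qed
  have 4: "\<bar>damped_sum X X\<bar> \<le> 2 + X"
    using mult_mono[OF abs_moebius_sum_exp_le[of X], of "exp (- X / X)" 1] X by (simp add: damped_sum_def abs_mult)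
  have "of_real (damped_sum X u) * (1 - iexp (pi * u / X)) - 2 * of_real (damped_sum X X) =
    of_real (damped_sum X u - damped_sum X X) * (1 - iexp (pi * u / X)) - of_real (damped_sum X X) * (1 + iexp (pi * u / X))"
    by (simp add: algebra_simps)
  also have "norm \<dots> \<le> \<bar>damped_sum X u - damped_sum X X\<bar> * norm (1 - iexp (pi * u / X)) + \<bar>damped_sum X X\<bar> * norm (1 + iexp (pi * u / X))"
    by (rule order_trans[OF norm_triangle_ineq4]) (simp add: norm_mult flip: of_real_diff)
  also have "\<dots> \<le> (4 * \<bar>u - X\<bar> + exp (- X / 2)) * 2 + (2 + X) * (4 * \<bar>u - X\<bar> / X)"
    using X by (intro add_mono mult_mono 1 2 3 4) auto
  finally have *: "norm (of_real (damped_sum X u) * (1 - iexp (pi * u / X)) - 2 * of_real (damped_sum X X)) \<le>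
    (4 * \<bar>u - X\<bar> + exp (- X / 2)) * 2 + (2 + X) * (4 * \<bar>u - X\<bar> / X)" .
  have "(2 + X) * (4 * \<bar>u - X\<bar> / X) = (2 + X) / X * (4 * \<bar>u - X\<bar>)" by simp
  also have "\<dots> \<le> 2 * (4 * \<bar>u - X\<bar>)" using X by (intro mult_right_mono) (auto simp: field_simps)
  finally show ?thesis using * abs_ge_zero[of "u - X"] by argo
qed

lemma std_normal_measure_le:
  assumes "r \<ge> 0"
  shows "(\<integral>t. (indicator {-r..r} t :: real) \<partial>std_normal_distribution) \<le> 2 * r"
proof -
  have int: "integrable lborel (\<lambda>t. (indicator {-r..r} t :: real) * 1)" by (auto intro!: integrable_real_indicator simp: emeasure_lborel_Icc_eq)
  have "(\<integral>t. (indicator {-r..r} t :: real) \<partial>std_normal_distribution) = (\<integral>t. std_normal_density t *\<^sub>R (indicator {-r..r} t :: real) \<partial>lborel)"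
    by (rule integral_density) auto
  also have "\<dots> \<le> (\<integral>t. (indicator {-r..r} t :: real) * 1 \<partial>lborel)"
  proof (rule integral_mono)
    have le: "std_normal_density t \<le> 1" for t
    proof -
      have "1 \<le> sqrt (2 * pi)" using pi_gt3 by simp
      hence "1 / sqrt (2 * pi) \<le> 1" by simp
      hence "1 / sqrt (2 * pi) * exp (- t\<^sup>2 / 2) \<le> 1 * 1" by (intro mult_mono) auto
      thus ?thesis by (simp add: std_normal_density_def)
    qed
    show "integrable lborel (\<lambda>t. std_normal_density t *\<^sub>R (indicator {-r..r} t :: real))"
      by (rule Bochner_Integration.integrable_bound[OF int]) (use le in \<open>auto simp: indicator_def\<close>)
    show "std_normal_density t *\<^sub>R (indicator {-r..r} t :: real) \<le> (indicator {-r..r} t :: real) * 1" for t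
      using le[of t] by (auto simp: indicator_def)
  qed (use int in simp)
  also have "\<dots> = 2 * r" using assms by simp
  finally show ?thesis .
qed

lemma std_normal_abs_moment:
  "integrable std_normal_distribution (\<lambda>v. \<bar>v\<bar>)" "(\<integral>v. \<bar>v\<bar> \<partial>std_normal_distribution) \<le> 1"
proof -
  have h: "has_bochner_integral lborel (\<lambda>v. std_normal_density v * \<bar>v\<bar>) (sqrt (2 / pi))"
    using std_normal_moment_abs_odd[of 0] by simp
  show "integrable std_normal_distribution (\<lambda>v. \<bar>v\<bar>)"
    by (subst integrable_density) (use h in \<open>auto simp: has_bochner_integral_iff\<close>)
  have "(\<integral>v. \<bar>v\<bar> \<partial>std_normal_distribution) = (\<integral>v. std_normal_density v *\<^sub>R \<bar>v\<bar> \<partial>lborel)"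
    by (rule integral_density) auto
  also have "\<dots> = sqrt (2 / pi)" using h by (simp add: has_bochner_integral_iff)
  also have "\<dots> \<le> 1" using pi_gt3 by simp
  finally show "(\<integral>v. \<bar>v\<bar> \<partial>std_normal_distribution) \<le> 1" .
qed

text \<open>The window width \<open>h\<close> is also the size of the smoothing error. On the
  frequency side, \<open>\<bar>t\<bar> \<le> r\<close> has Gaussian mass at most
  \<open>2 * r\<close>, and beyond it the Lipschitz bound gains \<open>(r / h) powr (-1/2)\<close>.
  With the exponents -3/5 and -1/5 this gain equals \<open>r\<close>, and the total
  \<open>r / (X * h)\<close> equals \<open>h\<close>.\<close>

lemma moebius_sum_exp_decay:
  obtains C X0 where "X0 \<ge> 1" "C > 0" "\<And>X. X \<ge> X0 \<Longrightarrow> \<bar>moebius_sum (exp X)\<bar> \<le> C * X powr (-3/5)"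
proof -
  interpret N: prob_space std_normal_distribution by (rule prob_space_normal_density) simp
  obtain C r0 where C: "C > 0" "0 < r0" "r0 \<le> 1" and lip:
    "\<And>\<delta> t1 t2 M. 0 < \<delta> \<Longrightarrow> \<delta> \<le> r0 \<Longrightarrow> t1 \<le> t2 \<Longrightarrow> (\<And>t. t1 \<le> t \<Longrightarrow> t \<le> t2 \<Longrightarrow> M \<le> 1 + \<bar>t\<bar>) \<Longrightarrow> M > 0 \<Longrightarrow>
       norm (1 / zeta_reg (Complex \<delta> t1) - 1 / zeta_reg (Complex \<delta> t2)) \<le> C * M powr (-1/2) * (t2 - t1)"
    using inverse_zeta_reg_lipschitz by blast
  \<comment> \<open>The 4 ensures \<open>pi / X \<le> 1\<close>; the other entry ensures
    \<open>1 / X \<le> r0\<close>.\<close>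
  define X0 where "X0 = max 4 (1 / r0)"
  define C' where "C' = exp 1 * (22 + C * 12)"
  have "\<bar>moebius_sum (exp X)\<bar> \<le> C' * X powr (-3/5)" if XX: "X \<ge> X0" for X
  proof -
    define \<delta> where "\<delta> = 1 / X"
    define h where "h = X powr (-3/5)"
    define r where "r = X powr (-1/5)"
    have X: "X \<ge> 4" "X \<ge> 1 / r0" using XX by (auto simp: X0_def)
    have \<delta>: "0 < \<delta>" "\<delta> \<le> r0" using X C by (auto simp: \<delta>_def field_simps)
    have h: "h > 0" using X by (simp add: h_def)
    have r: "r > 0" using X by (simp add: r_def)
    have rh: "r / h = X powr (2/5)" using X by (simp add: r_def h_def flip: powr_diff)
    have piX: "pi / X \<le> 1" using X pi_less_4 by simp
    define f where "f u = of_real (damped_sum X u) * (1 - iexp (pi * u / X))" for u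
    \<comment> \<open>The factor \<open>1 - iexp (pi * u / X)\<close> equals 2 at \<open>u = X\<close>, and its effect on the transform is a difference
      of two values at distance \<open>pi / X\<close>.\<close>
    define fh where "fh t = 1 / zeta_reg (Complex \<delta> t) - 1 / zeta_reg (Complex \<delta> (t - pi / X))" for t

    have fourier: "has_bochner_integral lborel (\<lambda>u. f u * iexp (- t * u)) (fh t)" for t
    proof -
      have "of_real (moebius_sum (exp u)) * exp (- Complex \<delta> t * of_real u) - of_real (moebius_sum (exp u)) * exp (- Complex \<delta> (t - pi / X) * of_real u)
        = f u * iexp (- t * u)" for u
      proof -
        have "- Complex \<delta> t * of_real u = of_real (- u / X) + \<i> * of_real (- t * u)"
          by (simp add: complex_eq_iff \<delta>_def)
        moreover have "- Complex \<delta> (t - pi / X) * of_real u = of_real (- u / X) + \<i> * of_real (- t * u) + \<i> * of_real (pi * u / X)"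
          by (simp add: complex_eq_iff \<delta>_def algebra_simps)
        ultimately show ?thesis
          by (simp only: exp_add f_def damped_sum_def exp_of_real of_real_mult) (simp add: algebra_simps)
      qed
      thus ?thesis
        using has_bochner_integral_diff[OF moebius_sum_laplace[of "Complex \<delta> t"] moebius_sum_laplace[of "Complex \<delta> (t - pi / X)"]] \<delta>
        by (simp add: fh_def)
    qed
    have fint: "integrable lborel f" using fourier[of 0] by (simp add: has_bochner_integral_iff)
    hence [measurable]: "f \<in> borel_measurable borel" by auto
    have fh_eq: "(\<integral>u. f u * iexp (- t * u) \<partial>lborel) = fh t" for t
      using fourier[of t] by (simp add: has_bochner_integral_iff)

    have fh1: "norm (fh t) \<le> C * (pi / X)" for t
      using lip[of \<delta> "t - pi / X" t 1] \<delta> X by (simp add: fh_def norm_minus_commute)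
    \<comment> \<open>The two arguments differ by \<open>pi / X \<le> 1\<close>, so
      \<open>1 + \<bar>s\<bar> \<ge> r / h\<close> holds along the whole segment between
      them.\<close>
    have fh2: "norm (fh (t / h)) \<le> C * (pi / X) * r" if t: "\<bar>t\<bar> > r" for t
    proof -
      have "norm (fh (t / h)) \<le> C * (r / h) powr (-1/2) * (pi / X)"
        unfolding fh_def
      proof (subst norm_minus_commute, rule order_trans[OF lip[of \<delta> "t / h - pi / X" "t / h" "r / h"]])
        fix s assume s: "t / h - pi / X \<le> s" "s \<le> t / h"
        have "r / h \<le> \<bar>t / h\<bar>" using t h by (simp add: divide_right_mono)
        also have "\<bar>t / h\<bar> \<le> \<bar>s\<bar> + \<bar>t / h - s\<bar>" by simp
        also have "\<bar>t / h - s\<bar> \<le> 1" using s piX by argo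
        finally show "r / h \<le> 1 + \<bar>s\<bar>" by simp
      qed (use \<delta> X r h in auto)
      also have "(r / h) powr (-1/2) = r" unfolding rh by (simp add: powr_powr r_def)
      finally show ?thesis by (simp add: mult_ac)
    qed

    have G: "of_real (h * sqrt (2 * pi)) * (\<integral>v. f (X + h * v) \<partial>std_normal_distribution) =
      (\<integral>t. iexp (t * X / h) * fh (t / h) \<partial>std_normal_distribution)"
      using gaussian_fourier[OF fint h, of X] by (simp only: fh_eq)
    have intI: "integrable std_normal_distribution (indicator {-r..r} :: real \<Rightarrow> real)"
      by (rule N.integrable_const_bound[of _ 1]) auto
    have prob_UNIV: "N.prob UNIV = 1" using N.prob_space by simp
    have "norm (\<integral>t. iexp (t * X / h) * fh (t / h) \<partial>std_normal_distribution) \<le> 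
      (\<integral>t. norm (iexp (t * X / h) * fh (t / h)) \<partial>std_normal_distribution)"
      by (rule integral_norm_bound)
    also have "\<dots> \<le> (\<integral>t. C * (pi / X) * indicator {-r..r} t + C * (pi / X) * r \<partial>std_normal_distribution)"
    proof (rule integral_mono')
      show "integrable std_normal_distribution (\<lambda>t. C * (pi / X) * indicator {-r..r} t + C * (pi / X) * r)"
        using intI by auto
      fix t
      have nn: "0 \<le> C * (pi / X)" "0 \<le> C * (pi / X) * r" using C X r by simp_all
      show "norm (iexp (t * X / h) * fh (t / h)) \<le> C * (pi / X) * indicator {-r..r} t + C * (pi / X) * r"
      proof (cases "\<bar>t\<bar> \<le> r")
        case True
        thus ?thesis using fh1[of "t / h"] nn by (auto simp: norm_mult indicator_def)
      next
        case False
        thus ?thesis using fh2[of t] by (auto simp: norm_mult indicator_def)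
      qed
      show "0 \<le> C * (pi / X) * indicator {-r..r} t + C * (pi / X) * r"
        by (intro add_nonneg_nonneg nn mult_nonneg_nonneg[OF nn(1)]) auto
    qed
    also have "\<dots> = C * (pi / X) * (\<integral>t. indicator {-r..r} t \<partial>std_normal_distribution) + C * (pi / X) * r"
      using intI by (subst Bochner_Integration.integral_add) (auto simp: prob_UNIV)
    also have "\<dots> \<le> C * (pi / X) * (2 * r) + C * (pi / X) * r"
      using C X r by (intro add_mono mult_left_mono std_normal_measure_le) auto
    also have "\<dots> = C * pi * 3 * (r / X)" by (simp add: field_simps)
    also have "\<dots> \<le> C * 4 * 3 * (r / X)" using C X r pi_less_4 by (intro mult_right_mono mult_left_mono) auto
    finally have up: "norm (\<integral>t. iexp (t * X / h) * fh (t / h) \<partial>std_normal_distribution) \<le> C * 12 * (r / X)" by (simp add: mult_ac)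

    have sq: "sqrt (2 * pi) \<ge> 1" using pi_gt3 by simp
    have "h * norm (\<integral>v. f (X + h * v) \<partial>std_normal_distribution) \<le> h * sqrt (2 * pi) * norm (\<integral>v. f (X + h * v) \<partial>std_normal_distribution)"
      using h sq by (intro mult_right_mono) auto
    also have "\<dots> = norm (of_real (h * sqrt (2 * pi)) * (\<integral>v. f (X + h * v) \<partial>std_normal_distribution))"
      using h by (simp add: norm_mult)
    also have "\<dots> \<le> C * 12 * (r / X)" unfolding G by (rule up)
    finally have le: "h * norm (\<integral>v. f (X + h * v) \<partial>std_normal_distribution) \<le> C * 12 * (r / X)" .
    have "norm (\<integral>v. f (X + h * v) \<partial>std_normal_distribution) \<le> C * 12 * (r / X) / h"
      unfolding pos_le_divide_eq[OF h] using le by (subst mult.commute)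
    also have "\<dots> = C * 12 * h"
    proof -
      have "r / X / h = r / h / X powr 1" using X by simp
      also have "\<dots> = h" unfolding rh using powr_diff[of X "2/5" 1] by (simp add: h_def)
      finally show ?thesis by (metis times_divide_eq_right)
    qed
    finally have up': "norm (\<integral>v. f (X + h * v) \<partial>std_normal_distribution) \<le> C * 12 * h" .

    have near: "norm (f (X + h * v) - 2 * of_real (damped_sum X X)) \<le> 20 * h * \<bar>v\<bar> + 2 * exp (- X / 2)" for v
      using damped_sum_near[of X "X + h * v"] X h by (simp add: f_def abs_mult)
    have intv: "integrable std_normal_distribution (\<lambda>v. 20 * h * \<bar>v\<bar> + 2 * exp (- X / 2))"
      by (intro Bochner_Integration.integrable_add integrable_mult_right std_normal_abs_moment) auto
    have intf: "integrable std_normal_distribution (\<lambda>v. f (X + h * v) - 2 * of_real (damped_sum X X))"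
      by (rule Bochner_Integration.integrable_bound[OF intv])
         (use order_trans[OF near abs_ge_self] in auto)
    have intf': "integrable std_normal_distribution (\<lambda>v. f (X + h * v))"
      using Bochner_Integration.integrable_add[OF intf N.integrable_const[of "2 * of_real (damped_sum X X)"]] by simp
    have "norm ((\<integral>v. f (X + h * v) \<partial>std_normal_distribution) - 2 * of_real (damped_sum X X)) = norm (\<integral>v. f (X + h * v) - 2 * of_real (damped_sum X X) \<partial>std_normal_distribution)"
      by (subst Bochner_Integration.integral_diff[OF intf']) (auto simp: prob_UNIV)
    also have "\<dots> \<le> (\<integral>v. 20 * h * \<bar>v\<bar> + 2 * exp (- X / 2) \<partial>std_normal_distribution)"
      by (rule Bochner_Integration.integral_norm_bound_integral[OF intf intv near])
    also have "\<dots> = 20 * h * (\<integral>v. \<bar>v\<bar> \<partial>std_normal_distribution) + 2 * exp (- X / 2)"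
      using std_normal_abs_moment(1) by (subst Bochner_Integration.integral_add) (auto simp: prob_UNIV)
    also have "\<dots> \<le> 20 * h * 1 + 2 * exp (- X / 2)"
      using h std_normal_abs_moment(2) by (intro add_mono mult_left_mono) auto
    also have "exp (- X / 2) \<le> h"
    proof -
      \<comment> \<open>The difference of the two sides is the square of
        \<open>1 - X / 4\<close>.\<close>
      have "X \<le> (1 + X / 4)\<^sup>2" using sum_squares_ge_zero[of "1 - X / 4" 0] by (simp add: power2_eq_square algebra_simps)
      also have "\<dots> \<le> (exp (X / 4))\<^sup>2" using exp_ge_add_one_self[of "X / 4"] X by (intro power_mono) auto
      also have "\<dots> = exp (X / 2)" by (simp add: power2_eq_square flip: exp_add)
      finally have "exp (- X / 2) \<le> 1 / X" using X by (simp add: exp_minus field_simps)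
      also have "\<dots> = X powr (-1)" using X by (simp add: powr_minus_divide)
      also have "\<dots> \<le> h" unfolding h_def using X by (intro powr_mono) auto
      finally show ?thesis .
    qed
    finally have "norm ((\<integral>v. f (X + h * v) \<partial>std_normal_distribution) - 2 * of_real (damped_sum X X)) \<le> 22 * h" by simp
    moreover have "norm (2 * of_real (damped_sum X X) :: complex) \<le> norm (\<integral>v. f (X + h * v) \<partial>std_normal_distribution) + 
        norm ((\<integral>v. f (X + h * v) \<partial>std_normal_distribution) - 2 * of_real (damped_sum X X))"
      using norm_triangle_sub[of "2 * of_real (damped_sum X X)" "\<integral>v. f (X + h * v) \<partial>std_normal_distribution"]
      by (subst (asm) norm_minus_commute)
    ultimately have "2 * \<bar>damped_sum X X\<bar> \<le> (22 + C * 12) * h" using up' by (simp add: norm_mult algebra_simps)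
    hence "\<bar>damped_sum X X\<bar> \<le> (22 + C * 12) * h" using C h by (smt (verit) mult_nonneg_nonneg)
    moreover have "\<bar>moebius_sum (exp X)\<bar> = exp 1 * \<bar>damped_sum X X\<bar>" using X by (simp add: damped_sum_def abs_mult exp_minus)
    ultimately show ?thesis by (simp add: C'_def h_def)
  qed
  moreover have "X0 \<ge> 1" "C' > 0" using C by (auto simp: X0_def C'_def intro!: mult_pos_pos add_pos_pos)
  ultimately show ?thesis using that by blast
qed

section \<open>Sums over primes\<close>

text \<open>Chebyshev's argument: with \<open>n = 2 ^ j\<close>, the primes in
  \<open>(n, 2 * n]\<close> all divide the central binomial coefficient, which is at most
  \<open>2 ^ (2 * n)\<close>, and each of them exceeds \<open>2 ^ j\<close>.\<close>

lemma card_primes_dyadic: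
  "card {p. prime p \<and> 2 ^ j < p \<and> p \<le> (2 ^ Suc j :: nat)} * j \<le> 2 ^ Suc j"
proof -
  define n :: nat where "n = 2 ^ j"
  define P where "P = {p. prime p \<and> n < p \<and> p \<le> 2 * n}"
  have fin: "finite P" unfolding P_def by (rule finite_subset[of _ "{..2 * n}"]) auto
  have dvd1: "p dvd (2 * n choose n)" if "p \<in> P" for p
  proof -
    have p: "prime p" "n < p" "p \<le> 2 * n" using that by (auto simp: P_def)
    have "fact n * fact (2 * n - n) * (2 * n choose n) = (fact (2 * n) :: nat)"
      by (rule binomial_fact_lemma) simp
    moreover have "p dvd (fact (2 * n) :: nat)" using p by (simp add: prime_dvd_fact_iff)
    ultimately have "p dvd fact n * fact n * (2 * n choose n)" by simp
    thus ?thesis using p by (auto simp: prime_dvd_mult_iff prime_dvd_fact_iff)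
  qed
  have "\<Prod>Q dvd (2 * n choose n)" if "finite Q" "Q \<subseteq> P" for Q
    using that
  proof (induction Q rule: finite_induct)
    case (insert p Q)
    have "coprime p (\<Prod>Q)"
    proof (rule prod_coprime_right)
      fix q assume "q \<in> Q"
      thus "coprime p q" using insert by (intro primes_coprime) (auto simp: P_def)
    qed
    hence "p * \<Prod>Q dvd (2 * n choose n)"
      using insert dvd1 by (intro divides_mult) auto
    thus ?case using insert by simp
  qed simp
  hence "\<Prod>P dvd (2 * n choose n)" using fin by blast
  hence "\<Prod>P \<le> (2 * n choose n)" by (rule dvd_imp_le) simp
  also have "\<dots> \<le> 2 ^ (2 * n)" by (rule binomial_le_pow2)
  finally have "\<Prod>P \<le> 2 ^ (2 * n)" .
  moreover have "(2 ^ j) ^ card P \<le> \<Prod>P"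
  proof -
    have "(\<Prod>p\<in>P. 2 ^ j) \<le> \<Prod>P" by (rule prod_mono) (auto simp: P_def n_def)
    thus ?thesis by simp
  qed
  ultimately have "(2::nat) ^ (j * card P) \<le> 2 ^ (2 * n)" by (simp add: power_mult)
  hence "j * card P \<le> 2 * n" by (subst (asm) power_increasing_iff) auto
  thus ?thesis by (simp add: P_def n_def mult.commute)
qed

text \<open>The denominator \<open>Suc j\<close> lets the bound include \<open>j = 0\<close>, where
  the counting estimate says nothing but 2 is the only prime.\<close>

lemma sum_inverse_primes_dyadic:
  "(\<Sum>p | prime p \<and> 2 ^ j < p \<and> p \<le> (2 ^ Suc j :: nat). 1 / real p) \<le> 4 / real (Suc j)"
proof -
  define P where "P = {p. prime p \<and> 2 ^ j < p \<and> p \<le> (2 ^ Suc j :: nat)}"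
  have fin: "finite P" unfolding P_def by (rule finite_subset[of _ "{..2 ^ Suc j}"]) auto
  have cd: "real (card P) * real j \<le> 2 * 2 ^ j"
    using card_primes_dyadic[of j] unfolding P_def[symmetric] by (metis of_nat_mult of_nat_le_iff of_nat_power of_nat_numeral power_Suc)
  have "(\<Sum>p\<in>P. 1 / real p) \<le> (\<Sum>p\<in>P. 1 / 2 ^ j)"
  proof (rule sum_mono)
    fix p assume "p \<in> P"
    hence "2 ^ j \<le> p" by (auto simp: P_def)
    hence "(2::real) ^ j \<le> real p" by (metis of_nat_le_iff of_nat_power of_nat_numeral)
    thus "1 / real p \<le> 1 / 2 ^ j" by (intro divide_left_mono mult_pos_pos) (auto intro: less_le_trans[of _ "2 ^ j"])
  qed
  also have "\<dots> = real (card P) / 2 ^ j" by simp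
  also have "\<dots> \<le> 4 / real (Suc j)"
  proof (cases "j = 0")
    case True
    have "P \<subseteq> {2}" using True by (auto simp: P_def)
    hence "card P \<le> card {2::nat}" by (intro card_mono) auto
    thus ?thesis using True by simp
  next
    case False
    have "real (card P) / 2 ^ j \<le> 2 / real j" using cd False by (simp add: field_simps)
    also have "\<dots> \<le> 4 / real (Suc j)" using False by (simp add: field_simps)
    finally show ?thesis .
  qed
  finally show ?thesis by (simp add: P_def)
qed

section \<open>Sums over indices prime to \<open>p\<close> and the reduction of
  \<open>m_omega\<close>\<close>

definition moebius_sum_cop :: "nat \<Rightarrow> real \<Rightarrow> real" where
  "moebius_sum_cop p x = (\<Sum>n | 1 \<le> n \<and> real n \<le> x. if p dvd n then 0 else real_of_int (moebius_mu n) / real n)"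

lemma sum_multiples:
  assumes "p > 0"
  shows "(\<Sum>n | (1 \<le> n \<and> real n \<le> x) \<and> p dvd n. g n) = (\<Sum>n | 1 \<le> n \<and> real n \<le> x / real p. g (p * n))"
  by (rule sum.reindex_bij_witness[of _ "\<lambda>n. p * n" "\<lambda>n. n div p"])
     (use assms in \<open>auto simp: field_simps elim!: dvdE\<close>)

text \<open>Multiplying by \<open>p\<close> flips the sign of \<open>moebius_mu\<close> when
  \<open>p\<close> does not divide \<open>n\<close> and kills it otherwise; this is where the
  coprimality condition arises.\<close>

lemma sum_moebius_multiples:
  assumes "prime p"
  shows "(\<Sum>n | 1 \<le> n \<and> real n \<le> x. real_of_int (moebius_mu (p * n)) / real (p * n)) = - (1 / real p) * moebius_sum_cop p x"
  unfolding moebius_sum_cop_def sum_distrib_left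
  by (rule sum.cong) (use assms in \<open>auto simp: moebius_mu_prime_mult\<close>)

lemma moebius_sum_cop_rec:
  assumes p: "prime p"
  shows "moebius_sum_cop p x = moebius_sum x + 1 / real p * moebius_sum_cop p (x / real p)"
proof -
  let ?A = "{n. 1 \<le> n \<and> real n \<le> x}"
  let ?g = "\<lambda>n. real_of_int (moebius_mu n) / real n"
  have "moebius_sum x - moebius_sum_cop p x = (\<Sum>n\<in>?A. if p dvd n then ?g n else 0)"
    unfolding moebius_sum_def moebius_sum_cop_def sum_subtractf[symmetric] by (rule sum.cong) auto
  also have "\<dots> = (\<Sum>n | (1 \<le> n \<and> real n \<le> x) \<and> p dvd n. ?g n)"
    by (subst sum.inter_filter[symmetric, OF finite_nat_le_real]) simp
  also have "\<dots> = - (1 / real p) * moebius_sum_cop p (x / real p)"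
    using p by (simp only: sum_multiples sum_moebius_multiples prime_gt_0_nat)
  finally show ?thesis by simp
qed

text \<open>\<open>omega n\<close> counts the primes \<open>p \<le> x\<close> dividing
  \<open>n\<close>; exchanging the sums leaves, for each \<open>p\<close>, a sum over multiples of
  \<open>p\<close>.\<close>

lemma m_omega_eq:
  "m_omega x = - (\<Sum>p | prime p \<and> real p \<le> x. 1 / real p * moebius_sum_cop p (x / real p))"
proof -
  let ?A = "{n. 1 \<le> n \<and> real n \<le> x}" and ?P = "{p. prime p \<and> real p \<le> x}"
  let ?g = "\<lambda>n. real_of_int (moebius_mu n) / real n"
  have finP: "finite ?P"
    by (rule finite_subset[OF _ finite_nat_le_real[of x]]) (auto simp: Suc_le_eq prime_gt_0_nat)
  have "m_omega x = (\<Sum>n\<in>?A. \<Sum>p\<in>?P. if p dvd n then ?g n else 0)"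
    unfolding m_omega_def
  proof (rule sum.cong[OF refl])
    fix n assume n: "n \<in> ?A"
    have le: "real p \<le> x" if "p dvd n" for p
      using n dvd_imp_le[OF that] by (auto intro: order_trans[of _ "real n"])
    have "{p \<in> ?P. p dvd n} = prime_factors n"
      using n le by (subst prime_factors_dvd) auto
    hence "(\<Sum>p\<in>?P. if p dvd n then ?g n else 0) = (\<Sum>p\<in>prime_factors n. ?g n)"
      using sum.inter_filter[OF finP, of "\<lambda>_. ?g n" "\<lambda>p. p dvd n"] by simp
    thus "real_of_int (moebius_mu n) * real (omega n) / real n = (\<Sum>p\<in>?P. if p dvd n then ?g n else 0)"
      by (simp add: omega_def)
  qed
  also have "\<dots> = (\<Sum>p\<in>?P. \<Sum>n\<in>?A. if p dvd n then ?g n else 0)" by (rule sum.swap)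
  also have "\<dots> = (\<Sum>p\<in>?P. - (1 / real p * moebius_sum_cop p (x / real p)))"
  proof (rule sum.cong[OF refl])
    fix p assume p: "p \<in> ?P"
    have "(\<Sum>n\<in>?A. if p dvd n then ?g n else 0) = (\<Sum>n | (1 \<le> n \<and> real n \<le> x) \<and> p dvd n. ?g n)"
      by (subst sum.inter_filter[symmetric, OF finite_nat_le_real]) simp
    also have "\<dots> = - (1 / real p) * moebius_sum_cop p (x / real p)"
      using p by (simp only: sum_multiples sum_moebius_multiples prime_gt_0_nat mem_Collect_eq)
    finally show "(\<Sum>n\<in>?A. if p dvd n then ?g n else 0) = - (1 / real p * moebius_sum_cop p (x / real p))" by simp
  qed
  finally show ?thesis by (simp add: sum_negf)
qed

text \<open>Using \<open>1 + ln x\<close> extends the estimate down to \<open>x = 1\<close>: above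
  \<open>X0 \<ge> 1\<close> the two logarithms differ by at most a factor 2, and below it the
  trivial bound is absorbed into the constant.\<close>

lemma moebius_sum_decay:
  obtains K where "K > 0" "\<And>x. x \<ge> 1 \<Longrightarrow> \<bar>moebius_sum x\<bar> \<le> K * (1 + ln x) powr (-3/5)"
proof -
  obtain C X0 where C: "X0 \<ge> 1" "C > 0" "\<And>X. X \<ge> X0 \<Longrightarrow> \<bar>moebius_sum (exp X)\<bar> \<le> C * X powr (-3/5)"
    using moebius_sum_exp_decay by blast
  define K where "K = C * (1/2) powr (-3/5) + (2 + X0) * (1 + X0) powr (3/5)"
  have "\<bar>moebius_sum x\<bar> \<le> K * (1 + ln x) powr (-3/5)" if x: "x \<ge> 1" for x
  proof -
    define X where "X = ln x"
    have X: "X \<ge> 0" "x = exp X" using x by (auto simp: X_def)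
    show ?thesis
    proof (cases "X \<ge> X0")
      case True
      have "\<bar>moebius_sum x\<bar> \<le> C * X powr (-3/5)" using C True X by simp
      also have "X powr (-3/5) \<le> (1/2 * (1 + X)) powr (-3/5)"
        using True C X by (intro powr_mono2') auto
      also have "\<dots> = (1/2) powr (-3/5) * (1 + X) powr (-3/5)"
        using X by (intro powr_mult)
      finally have "\<bar>moebius_sum x\<bar> \<le> C * (1/2) powr (-3/5) * (1 + X) powr (-3/5)" using C by simp
      also have "\<dots> \<le> K * (1 + X) powr (-3/5)"
        using C by (intro mult_right_mono) (auto simp: K_def)
      finally show ?thesis by (simp add: X_def)
    next
      case False
      have "\<bar>moebius_sum x\<bar> \<le> (2 + X0) * 1" using abs_moebius_sum_exp_le[OF X(1)] X False by simp
      also have "1 = (1 + X0) powr (3/5) * (1 + X0) powr (-3/5)"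
        using C by (simp flip: powr_add)
      also have "(1 + X0) powr (-3/5) \<le> (1 + X) powr (-3/5)"
        using X False by (intro powr_mono2') auto
      finally have "\<bar>moebius_sum x\<bar> \<le> (2 + X0) * (1 + X0) powr (3/5) * (1 + X) powr (-3/5)" using C by (simp add: mult_left_mono)
      also have "\<dots> \<le> K * (1 + X) powr (-3/5)"
        using C by (intro mult_right_mono) (auto simp: K_def)
      finally show ?thesis by (simp add: X_def)
    qed
  qed
  moreover have "K > 0" using C by (auto simp: K_def intro!: add_pos_pos mult_pos_pos)
  ultimately show ?thesis using that by blast
qed

text \<open>The factor below 1 is what closes the induction for \<open>moebius_sum_cop\<close>. It
  follows from \<open>ln p \<le> p / exp 1\<close>, \<open>exp 1 \<ge> 5/2\<close> and
  \<open>1 \<le> p / 2\<close>.\<close>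

lemma one_plus_ln_le:
  fixes p :: real
  assumes "p \<ge> 2"
  shows "1 + ln p \<le> 9 / 10 * p"
proof -
  have e: "exp 1 \<ge> (5/2 :: real)" using exp_lower_Taylor_quadratic[of "1::real"] by simp
  have "ln p = 1 + ln (p / exp 1)" using assms by (simp add: ln_div)
  also have "ln (p / exp 1) \<le> p / exp 1 - 1" using assms by (intro ln_le_minus_one) auto
  also have "p / exp 1 \<le> p / (5/2)" using assms e by (intro divide_left_mono) auto
  finally show ?thesis using assms by simp
qed

text \<open>Induction along \<open>x\<close> to \<open>x / p\<close>. Passing to
  \<open>x / p\<close> worsens the bound by at most \<open>1 + ln p\<close>, while the recursion
  supplies \<open>1 / p\<close>; the net factor is at most 9/10. The constant \<open>10 * K\<close>
  then reproduces itself as \<open>K + 9 * K\<close>, uniformly in \<open>p\<close>.\<close>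

lemma moebius_sum_cop_decay:
  obtains K where "K > 0" "\<And>p x. prime p \<Longrightarrow> x \<ge> 1 \<Longrightarrow> \<bar>moebius_sum_cop p x\<bar> \<le> K * (1 + ln x) powr (-3/5)"
proof -
  obtain K where K: "K > 0" "\<And>x. x \<ge> 1 \<Longrightarrow> \<bar>moebius_sum x\<bar> \<le> K * (1 + ln x) powr (-3/5)"
    using moebius_sum_decay by blast
  have "\<bar>moebius_sum_cop p x\<bar> \<le> (10 * K) * (1 + ln x) powr (-3/5)" if p: "prime p" and x: "x \<ge> 1" for p x
    using x
  proof (induction "nat \<lfloor>x\<rfloor>" arbitrary: x rule: less_induct)
    case less
    define e where "e = (1 + ln x) powr (-3/5)"
    have e: "e \<ge> 0" by (simp add: e_def)
    have p2: "real p \<ge> 2" using prime_ge_2_nat[OF p] by simp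
    have "\<bar>1 / real p * moebius_sum_cop p (x / real p)\<bar> \<le> 9 * K * e"
    proof (cases "x < real p")
      case True
      hence lt: "x / real p < 1" using p2 by simp
      have "\<not> (1 \<le> n \<and> real n \<le> x / real p)" for n
      proof (intro notI)
        assume "1 \<le> n \<and> real n \<le> x / real p"
        hence "real n < 1" "1 \<le> n" using lt by (blast intro: le_less_trans, blast)
        thus False by simp
      qed
      hence emp: "{n. 1 \<le> n \<and> real n \<le> x / real p} = {}" by blast
      show ?thesis unfolding moebius_sum_cop_def emp using K e by simp
    next
      case False
      hence xp: "x / real p \<ge> 1" using p2 by simp
      \<comment> \<open>Since \<open>x \<ge> p \<ge> 2\<close>, the argument drops by at least 1, so
        the floor strictly decreases.\<close>
      have "x / real p \<le> x / 2" using p2 less.prems by (intro divide_left_mono) auto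
      also have "\<dots> \<le> x - 1" using False p2 by simp
      finally have "\<lfloor>x / real p\<rfloor> \<le> \<lfloor>x - 1\<rfloor>" by (rule floor_mono)
      hence "nat \<lfloor>x / real p\<rfloor> < nat \<lfloor>x\<rfloor>" using xp less.prems by simp
      from less.hyps[OF this xp] 
      have IH: "\<bar>moebius_sum_cop p (x / real p)\<bar> \<le> 10 * K * (1 + ln (x / real p)) powr (-3/5)" .
      define L l where "L = ln x" and "l = ln (real p)"
      have Ll: "0 \<le> l" "l \<le> L" using False p2 less.prems by (auto simp: L_def l_def)
      have "(1 + ln (x / real p)) powr (-3/5) = (1 + L - l) powr (-3/5)"
        using p2 less.prems by (simp add: ln_div L_def l_def add_diff_eq)
      also have "\<dots> \<le> ((1 + L) / (1 + l)) powr (-3/5)"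
      proof (rule powr_mono2')
        \<comment> \<open>This product is the excess of \<open>(1 + l) * (1 + L - l)\<close> over
          \<open>1 + L\<close>.\<close>
        have "0 \<le> l * (L - l)" using Ll by simp
        thus "(1 + L) / (1 + l) \<le> 1 + L - l" using Ll by (simp add: field_simps)
      qed (use Ll in auto)
      also have "\<dots> = (1 + l) powr (3/5) * e"
        using Ll by (simp add: powr_divide e_def L_def powr_minus field_simps)
      also have "\<dots> \<le> (1 + l) powr 1 * e"
        using Ll e by (intro mult_right_mono powr_mono) auto
      also have "\<dots> \<le> (9/10 * real p) * e"
        using one_plus_ln_le[OF p2] Ll e by (intro mult_right_mono) (auto simp: l_def)
      finally have "\<bar>moebius_sum_cop p (x / real p)\<bar> \<le> 10 * K * (9/10 * real p * e)"
        using K by (intro order_trans[OF IH] mult_left_mono) auto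
      hence "1 / real p * \<bar>moebius_sum_cop p (x / real p)\<bar> \<le> 1 / real p * (10 * K * (9/10 * real p * e))"
        by (intro mult_left_mono) auto
      also have "\<dots> = 9 * K * e" using p2 by simp
      finally show ?thesis by (simp add: abs_mult)
    qed
    moreover have "\<bar>moebius_sum x\<bar> \<le> K * e" using K(2)[OF less.prems] by (simp add: e_def)
    moreover have "\<bar>moebius_sum_cop p x\<bar> \<le> \<bar>moebius_sum x\<bar> + \<bar>1 / real p * moebius_sum_cop p (x / real p)\<bar>"
      by (subst moebius_sum_cop_rec[OF p]) (rule abs_triangle_ineq)
    ultimately show ?case by (simp add: e_def)
  qed
  thus ?thesis using that[of "10 * K"] K by simp
qed

text \<open>With \<open>b powr (-3/5) = b powr (2/5) / b\<close> and the partial fractions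
  \<open>1 / (a * b) = (1 / a + 1 / b) / (a + b)\<close>, where \<open>a + b\<close> exceeds
  \<open>Suc J\<close> by one, the convolution reduces to two harmonic sums.\<close>

lemma sum_inverse_powr_le:
  "(\<Sum>j\<le>J. 1 / real (Suc j) * real (Suc (J - j)) powr (-3/5)) \<le> 2 * real (Suc J) powr (-3/5) * (1 + ln (real (Suc J)))"
proof -
  define H where "H = (\<Sum>j\<le>J. 1 / real (Suc j))"
  have rev: "(\<Sum>j\<le>J. 1 / real (Suc (J - j))) = H"
    unfolding H_def by (rule sum.reindex_bij_witness[of _ "\<lambda>j. J - j" "\<lambda>j. J - j"]) auto
  have "(\<Sum>j\<le>J. 1 / real (Suc j) * real (Suc (J - j)) powr (-3/5)) \<le>
    (\<Sum>j\<le>J. real (Suc J) powr (-3/5) * (1 / real (Suc j) + 1 / real (Suc (J - j))))"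
  proof (rule sum_mono)
    fix j assume "j \<in> {..J}"
    hence j: "j \<le> J" by simp
    define a b where "a = real (Suc j)" and "b = real (Suc (J - j))"
    have ab: "a \<ge> 1" "b \<ge> 1" "a + b = real (Suc J) + 1" "b \<le> real (Suc J)" using j by (auto simp: a_def b_def of_nat_diff)
    have "1 / a * b powr (-3/5) = b powr (2/5) * (1 / a * (1 / b))"
      using ab powr_diff[of b "2/5" 1] by simp
    also have "1 / a * (1 / b) = 1 / (a + b) * (1 / a + 1 / b)"
      using ab by (simp add: field_simps)
    also have "b powr (2/5) * (1 / (a + b) * (1 / a + 1 / b)) \<le> real (Suc J) powr (2/5) * (1 / real (Suc J) * (1 / a + 1 / b))"
      using ab by (intro mult_mono powr_mono2 divide_left_mono mult_pos_pos) auto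
    also have "\<dots> = real (Suc J) powr (-3/5) * (1 / a + 1 / b)"
      using powr_diff[of "real (Suc J)" "2/5" 1] by simp
    finally show "1 / real (Suc j) * real (Suc (J - j)) powr (-3/5) \<le> real (Suc J) powr (-3/5) * (1 / real (Suc j) + 1 / real (Suc (J - j)))"
      by (simp add: a_def b_def)
  qed
  also have "\<dots> = real (Suc J) powr (-3/5) * (2 * H)"
    by (simp only: sum_distrib_left[symmetric] sum.distrib rev H_def[symmetric]) simp
  also have "H \<le> 1 + ln (real (Suc J))"
  proof -
    have "H \<le> 1 + ln (real (Suc J))" 
      unfolding H_def
    proof (induction J)
      case (Suc J)
      have "1 / real (Suc (Suc J)) \<le> ln (real (Suc (Suc J))) - ln (real (Suc J))"
      proof -
        have "ln (real (Suc J) / real (Suc (Suc J))) \<le> real (Suc J) / real (Suc (Suc J)) - 1"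
          by (intro ln_le_minus_one) auto
        also have "\<dots> = - (1 / real (Suc (Suc J)))" by (simp add: field_simps)
        finally show ?thesis by (simp add: ln_div del: of_nat_Suc)
      qed
      thus ?case using Suc by (simp del: of_nat_Suc)
    qed simp
    thus ?thesis .
  qed
  hence "real (Suc J) powr (-3/5) * (2 * H) \<le> real (Suc J) powr (-3/5) * (2 * (1 + ln (real (Suc J))))"
    by (intro mult_left_mono) auto
  finally show ?thesis by (simp only: mult_ac)
qed

text \<open>The primes are sorted into the intervals \<open>(2 ^ j, 2 ^ Suc j]\<close>. There the
  inverse primes sum to \<open>O(1 / (j + 1))\<close> and \<open>1 + ln (x / p)\<close> is at least
  \<open>(J - j + 1) / 2\<close>. The logarithm from the resulting convolution is absorbed by
  \<open>Suc J powr (1/10)\<close>, and -3/5 + 1/10 = -1/2.\<close>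

lemma m_omega_bound:
  obtains C where "C > 0" "\<And>x. x \<ge> 2 \<Longrightarrow> \<bar>m_omega x\<bar> \<le> C / sqrt (ln x)"
proof -
  obtain K where K: "K > 0" "\<And>p x. prime p \<Longrightarrow> x \<ge> 1 \<Longrightarrow> \<bar>moebius_sum_cop p x\<bar> \<le> K * (1 + ln x) powr (-3/5)"
    using moebius_sum_cop_decay by blast
  have ln2: "1 / 2 \<le> ln (2::real)"
    using exp_half_le2 by (subst ln_ge_iff) auto
  have "\<bar>m_omega x\<bar> \<le> (160 * K) / sqrt (ln x)" if x: "x \<ge> 2" for x
  proof -
    define J where "J = nat \<lfloor>log 2 x\<rfloor>"
    have lg: "log 2 x \<ge> 1" using x by simp
    have J: "real J \<le> log 2 x" "log 2 x < real J + 1" using lg by (auto simp: J_def)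
    have Jx: "2 ^ J \<le> x"
    proof -
      have "2 powr real J \<le> 2 powr (log 2 x)" using J by (intro powr_mono) auto
      thus ?thesis using x by (simp add: powr_realpow)
    qed
    have Jx': "x < 2 ^ Suc J"
    proof -
      have "2 powr (log 2 x) < 2 powr real (Suc J)" using J by (intro powr_less_mono) auto
      thus ?thesis using x powr_realpow[of 2 "Suc J"] by simp
    qed
    define P where "P = {p. prime p \<and> real p \<le> x}"
    define D where "D j = {p. prime p \<and> 2 ^ j < p \<and> p \<le> (2 ^ Suc j :: nat)}" for j
    have finP: "finite P" unfolding P_def
      by (rule finite_subset[OF _ finite_nat_le_real[of x]]) (auto simp: Suc_le_eq prime_gt_0_nat)
    have finD: "finite (D j)" for j
      unfolding D_def by (rule finite_subset[of _ "{..2 ^ Suc j}"]) auto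
    have cover: "P \<subseteq> (\<Union>j\<le>J. P \<inter> D j)"
    proof
      fix p assume p: "p \<in> P"
      hence p2: "p \<ge> 2" and px: "real p \<le> x" by (auto simp: P_def prime_ge_2_nat)
      \<comment> \<open>Minimality gives \<open>2 ^ j < p\<close>; for \<open>j = 0\<close> this is
        just \<open>p \<ge> 2\<close>, so the prime 2 lies in the first interval.\<close>
      define j where "j = (LEAST j. p \<le> 2 ^ Suc j)"
      have ex: "p \<le> 2 ^ Suc p"
        using order_trans[OF less_imp_le[OF less_exp[of p]], of "2 ^ Suc p"] by simp
      have j1: "p \<le> 2 ^ Suc j" unfolding j_def by (rule LeastI[of "\<lambda>j. p \<le> 2 ^ Suc j" p, OF ex])
      have j2: "2 ^ j < p"
      proof (cases j)
        case 0
        thus ?thesis using p2 by simp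
      next
        case (Suc i)
        have "\<not> p \<le> 2 ^ Suc i" using not_less_Least[of i "\<lambda>j. p \<le> 2 ^ Suc j"] Suc by (simp add: j_def)
        thus ?thesis using Suc by simp
      qed
      have "(2::real) ^ j < real p" using j2 by (metis of_nat_less_iff of_nat_power of_nat_numeral)
      hence "(2::real) ^ j < 2 ^ Suc J" using px Jx' by linarith
      hence "j < Suc J" by (rule power_less_imp_less_exp[rotated]) simp
      thus "p \<in> (\<Union>j\<le>J. P \<inter> D j)" using p j1 j2 by (auto simp: D_def P_def)
    qed
    let ?t = "\<lambda>p. 1 / real p * \<bar>moebius_sum_cop p (x / real p)\<bar>"
    have "\<bar>m_omega x\<bar> \<le> (\<Sum>p\<in>P. ?t p)"
      unfolding m_omega_eq P_def[symmetric] abs_minus_cancel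
      by (rule order_trans[OF sum_abs]) (simp add: abs_mult)
    also have "\<dots> \<le> (\<Sum>p\<in>P. \<Sum>j\<le>J. if p \<in> D j then ?t p else 0)"
    proof (rule sum_mono)
      fix p assume "p \<in> P"
      then obtain j where j: "j \<le> J" "p \<in> D j" using cover by blast
      have "?t p = (\<Sum>i\<in>{j}. if p \<in> D i then ?t p else 0)" using j by simp
      also have "\<dots> \<le> (\<Sum>i\<le>J. if p \<in> D i then ?t p else 0)"
        by (rule sum_mono2) (use j in auto)
      finally show "?t p \<le> (\<Sum>j\<le>J. if p \<in> D j then ?t p else 0)" .
    qed
    also have "\<dots> = (\<Sum>j\<le>J. \<Sum>p\<in>P. if p \<in> D j then ?t p else 0)" by (rule sum.swap)
    also have "\<dots> = (\<Sum>j\<le>J. \<Sum>p\<in>P \<inter> D j. ?t p)"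
      by (intro sum.cong refl sum.inter_restrict[symmetric] finP)
    also have "\<dots> \<le> (\<Sum>j\<le>J. 8 * K * (1 / real (Suc j) * real (Suc (J - j)) powr (-3/5)))"
    proof (rule sum_mono)
      fix j assume "j \<in> {..J}"
      hence j: "j \<le> J" by simp
      define b where "b = real (Suc (J - j))"
      have b: "b \<ge> 1" by (simp add: b_def)
      have bound: "?t p \<le> 2 * K * b powr (-3/5) * (1 / real p)" if p: "p \<in> P \<inter> D j" for p
      proof -
        have pp: "prime p" "real p \<le> x" "p \<le> 2 ^ Suc j" using p by (auto simp: P_def D_def)
        have p0: "real p > 0" using pp prime_gt_0_nat by simp
        have xp: "x / real p \<ge> 1" using pp p0 by simp
        have "b / 2 \<le> 1 + ln (x / real p)"
        \<comment> \<open>In the last block only \<open>x / p \<ge> 1\<close> is known, which is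
          enough because \<open>b = 1\<close>. Otherwise \<open>x / p \<ge> 2 ^ (J - Suc j)\<close>
          and \<open>ln 2 \<ge> 1/2\<close>.\<close>
        proof (cases "j = J")
          case True
          have "0 \<le> ln (x / real p)" using xp by simp
          thus ?thesis using True by (simp add: b_def)
        next
          case False
          hence jJ: "Suc j \<le> J" using j by simp
          have "real p \<le> 2 ^ Suc j" using pp(3) by (metis of_nat_le_iff of_nat_power of_nat_numeral)
          hence "2 ^ J / 2 ^ Suc j \<le> x / real p" using Jx p0 x by (intro frac_le) auto
          hence "2 ^ (J - Suc j) \<le> x / real p" using jJ by (simp add: power_diff)
          hence "ln (2 ^ (J - Suc j)) \<le> ln (x / real p)" using xp by (subst ln_le_cancel_iff) auto
          hence "real (J - Suc j) * ln 2 \<le> ln (x / real p)" by (simp add: ln_realpow)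
          moreover have "real (J - Suc j) * (1/2) \<le> real (J - Suc j) * ln 2" using ln2 by (intro mult_left_mono) auto
          moreover have "real (J - Suc j) = b - 2" using jJ by (simp add: b_def of_nat_diff)
          ultimately show ?thesis by argo
        qed
        hence "(1 + ln (x / real p)) powr (-3/5) \<le> (b / 2) powr (-3/5)"
          using b by (intro powr_mono2') auto
        also have "\<dots> = b powr (-3/5) * 2 powr (3/5)" using b by (simp add: powr_divide powr_minus field_simps)
        also have "\<dots> \<le> b powr (-3/5) * 2 powr 1" by (intro mult_left_mono powr_mono) auto
        finally have "K * (1 + ln (x / real p)) powr (-3/5) \<le> K * (b powr (-3/5) * 2 powr 1)"
          using K by (intro mult_left_mono) auto
        hence "\<bar>moebius_sum_cop p (x / real p)\<bar> \<le> K * (b powr (-3/5) * 2)" using K(2)[OF pp(1) xp] by simp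
        hence "1 / real p * \<bar>moebius_sum_cop p (x / real p)\<bar> \<le> 1 / real p * (K * (b powr (-3/5) * 2))"
          by (intro mult_left_mono) auto
        thus ?thesis by (simp add: mult_ac)
      qed
      have "(\<Sum>p\<in>P \<inter> D j. ?t p) \<le> (\<Sum>p\<in>P \<inter> D j. 2 * K * b powr (-3/5) * (1 / real p))"
        by (rule sum_mono) (rule bound)
      also have "\<dots> \<le> (\<Sum>p\<in>D j. 2 * K * b powr (-3/5) * (1 / real p))"
        by (rule sum_mono2) (use finD K in auto)
      also have "\<dots> = 2 * K * b powr (-3/5) * (\<Sum>p\<in>D j. 1 / real p)" by (rule sum_distrib_left[symmetric])
      also have "\<dots> \<le> 2 * K * b powr (-3/5) * (4 / real (Suc j))"
        unfolding D_def using K by (intro mult_left_mono sum_inverse_primes_dyadic) auto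
      also have "\<dots> = 8 * K * (1 / real (Suc j) * b powr (-3/5))" by simp
      finally show "(\<Sum>p\<in>P \<inter> D j. ?t p) \<le> 8 * K * (1 / real (Suc j) * real (Suc (J - j)) powr (-3/5))"
        by (simp only: b_def)
    qed
    also have "\<dots> = 8 * K * (\<Sum>j\<le>J. 1 / real (Suc j) * real (Suc (J - j)) powr (-3/5))"
      by (rule sum_distrib_left[symmetric])
    also have "\<dots> \<le> 8 * K * (2 * real (Suc J) powr (-3/5) * (1 + ln (real (Suc J))))"
      using K by (intro mult_left_mono sum_inverse_powr_le) auto
    also have "\<dots> \<le> 8 * K * (2 * real (Suc J) powr (-3/5) * (10 * real (Suc J) powr (1/10)))"
    proof (intro mult_left_mono)
      \<comment> \<open>\<open>ln z \<le> z - 1\<close> at \<open>z = Suc J powr (1/10)\<close>,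
        multiplied by 10.\<close>
      have "ln (real (Suc J) powr (1/10)) \<le> real (Suc J) powr (1/10) - 1"
        by (rule ln_le_minus_one) simp
      moreover have "ln (real (Suc J) powr (1/10)) = 1/10 * ln (real (Suc J))" by (rule ln_powr) 
      ultimately show "1 + ln (real (Suc J)) \<le> 10 * real (Suc J) powr (1/10)" by argo
    qed (use K in auto)
    also have "\<dots> = 160 * K * (real (Suc J) powr (-3/5) * real (Suc J) powr (1/10))" by simp
    also have "real (Suc J) powr (-3/5) * real (Suc J) powr (1/10) = real (Suc J) powr (-1/2)"
      by (simp flip: powr_add)
    also have "160 * K * real (Suc J) powr (-1/2) \<le> 160 * K * ln x powr (-1/2)"
    proof (intro mult_left_mono powr_mono2')
      have "ln x \<le> log 2 x"
      proof -
        have "ln x * ln 2 \<le> ln x * 1" using x ln_2_less_1 by (intro mult_left_mono) auto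
        thus ?thesis by (simp add: log_def field_simps)
      qed
      thus "ln x \<le> real (Suc J)" using J by simp
    qed (use K x in auto)
    also have "ln x powr (-1/2) = 1 / sqrt (ln x)"
      using x by (simp add: powr_half_sqrt[symmetric] powr_minus_divide)
    finally show ?thesis by simp
  qed
  thus ?thesis using that[of "160 * K"] K by simp
qed

theorem theorem4:
  shows "m_omega \<in> O[at_top](\<lambda>x::real. sqrt (ln (ln x)) / sqrt (ln x)) \<and>
    (\<lambda>k. real_of_int (moebius_mu (k + 1)) * real (omega (k + 1)) / real (k + 1)) sums 0 \<and>
    (\<lambda>k. real_of_int (moebius_mu (k + 2)) * real (omega (k + 2)) / real (k + 2)) sums 0"
proof -
  obtain C where C: "C > 0" "\<And>x. x \<ge> 2 \<Longrightarrow> \<bar>m_omega x\<bar> \<le> C / sqrt (ln x)"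
    using m_omega_bound by blast
  let ?f = "\<lambda>n. real_of_int (moebius_mu n) * real (omega n) / real n"
  have bigo: "m_omega \<in> O[at_top](\<lambda>x::real. sqrt (ln (ln x)) / sqrt (ln x))"
  proof (rule bigoI)
    \<comment> \<open>Once \<open>ln (ln x) \<ge> 1\<close>, the stronger bound
      \<open>C / sqrt (ln x)\<close> implies the stated one.\<close>
    have ev: "eventually (\<lambda>x::real. ln (ln x) \<ge> 1) at_top" by real_asymp
    show "\<forall>\<^sub>F x in at_top. norm (m_omega x) \<le> C * norm (sqrt (ln (ln x)) / sqrt (ln x))"
      using ev eventually_ge_at_top[of 2]
    proof eventually_elim
      case (elim x)
      have nn: "0 \<le> sqrt (ln (ln x)) / sqrt (ln x)"
      proof (intro divide_nonneg_nonneg real_sqrt_ge_zero)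
        show "0 \<le> ln (ln x)" by (rule order_trans[OF zero_le_one elim(1)])
        show "0 \<le> ln x" using elim by simp
      qed
      have "norm (m_omega x) \<le> C / sqrt (ln x)" using C(2)[of x] elim by simp
      also have "\<dots> \<le> C * (sqrt (ln (ln x)) / sqrt (ln x))"
        using C elim by (simp add: divide_right_mono)
      also have "C * (sqrt (ln (ln x)) / sqrt (ln x)) = C * norm (sqrt (ln (ln x)) / sqrt (ln x))"
        using nn by (simp only: real_norm_def abs_of_nonneg)
      finally show ?case .
    qed
  qed
  have "((\<lambda>n::nat. C / sqrt (ln (real n))) \<longlongrightarrow> 0) sequentially" by real_asymp
  moreover have "eventually (\<lambda>n::nat. norm (m_omega (real n)) \<le> C / sqrt (ln (real n))) sequentially"
    using eventually_ge_at_top[of 2] by eventually_elim (use C in auto)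
  ultimately have lim: "(\<lambda>n::nat. m_omega (real n)) \<longlonglongrightarrow> 0"
    by (rule Lim_null_comparison[rotated])
  \<comment> \<open>The partial sums of the series are the values of \<open>m_omega\<close> at the
    naturals, so its decay is convergence to 0.\<close>
  have part: "m_omega (real n) = (\<Sum>k<n. ?f (Suc k))" for n :: nat
    unfolding m_omega_def by (rule sum.reindex_bij_witness[of _ Suc "\<lambda>k. k - 1"]) auto
  have s1: "(\<lambda>k. ?f (Suc k)) sums 0"
    using lim unfolding part sums_def .
  \<comment> \<open>The term at \<open>n = 1\<close> vanishes because \<open>omega 1 = 0\<close>, so
    dropping it leaves the value unchanged.\<close>
  have "(\<lambda>k. ?f (Suc (Suc k))) sums 0"
    using s1 by (subst sums_Suc_iff) (simp add: omega_def)
  thus ?thesis using bigo s1 by (simp add: numeral_2_eq_2)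
qed

end
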